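(* Let $\omega$ be a weight function with constants $K,b$, and let $1\le p\le\infty$. (i) Let $\sigma\in\mathcal{S}'_\omega(\mathbb{R}^{2N})$ satisfy $\|e^{\nu\omega}\sigma\|_{p'}<\infty$ for every $\nu\ge0$. Then for every $\lambda\ge0$ and $f\in\mathcal{S}_\omega(\mathbb{R}^N)$, $$\|e^{\lambda\omega}Q_\sigma f\|_\infty\le D_\lambda^{(9)}\,\|e^{K\lambda\omega}\mathrm{Wig}(f)\|_p,\qquad D_\lambda^{(9)}=e^{K\lambda}\|e^{K\lambda\omega}\sigma\|_{p'}.$$ (ii) Let $\sigma\in\mathcal{S}'_\omega(\mathbb{R}^{2N})$ satisfy $\|e^{\nu\omega}\sigma\|_1<\infty$ for every $\nu\ge0$. Then for every $\lambda\ge0$ and $f\in\mathcal{S}_\omega(\mathbb{R}^N)$, $$\|e^{\lambda\omega}Q_\sigma f\|_\infty^2\le D_\lambda^{(10)}\,\|e^{4K^3\lambda\omega}Rf\|_p\,\|e^{4K^3\lambda\omega}Rf\|_{p'},\qquad D_\lambda^{(10)}=\Big(\frac4{2\pi}\Big)^Ne^{K(2+K+2K^2)\lambda}\|e^{K\lambda\omega}\sigma\|_1^2.$$ (iii) Let $\sigma\in\mathcal{S}'_\omega(\mathbb{R}^{2N})$ satisfy $\|e^{\nu\omega}\sigma\|_1<\infty$ for every $\nu\ge0$, and let $g\in\mathcal{S}_\omega(\mathbb{R}^N)$, $g\ne0$. Then for every $\lambda\ge0$, $\mu>\frac{2N}{b}\left(K^2+\frac2{(2p)'}\right)$ and $f\in\mathcal{S}_\omega(\mathbb{R}^N)$,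 $$\|e^{\lambda\omega}Q_\sigma f\|_\infty\le D_{\lambda,\mu}^{(11)}\,\|e^{(8K^5\lambda+\mu)\omega}Sp_gf\|_p,\qquad D_{\lambda,\mu}^{(11)}=e^{K\lambda}\,D_{K\lambda,\mu}^{(6)}\,\|e^{K\lambda\omega}\sigma\|_1,$$ where, for $s\ge0$, $$D^{(6)}_{s,\mu}=\frac{2^N\,e^{\frac K2(1+2K)s}}{(2\pi)^{\frac52N}\|g\|_2^4}\;\inf\Big[e^{K(1+2K)(4K^2s+\mu')}\|e^{K^2(4K^2s+\mu')\omega}g\|_\infty\,\|e^{K^2(4K^2s+\mu')\omega}\hat g\|_\infty\,\|e^{-\mu'\omega}\|_{L^2(\mathbb{R}^{2N})}\,\|e^{-\mu''\omega}\|^2_{L^{(2p)'}(\mathbb{R}^{2N})}\Big],$$ the infimum being taken over all $\mu',\mu''$ with $2(K^2\mu'+\mu'')=\mu$, $\mu'>\frac Nb$ and $\mu''>\frac{2N}{b(2p)'}$.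
   Context: A weight function is a continuous increasing (i.e. nondecreasing) function $\omega:[0,\infty)\to[0,\infty)$ such that: ($\alpha$) there is $K\ge1$ with $\omega(2t)\le K(1+\omega(t))$ for all $t\ge0$; ($\beta$) $\omega(t)=o(t)$ as $t\to\infty$; ($\gamma$) there are $a\in\mathbb{R}$, $b>0$ with $\omega(t)\ge a+b\log(1+t)$ for all $t\ge0$; ($\delta$) $t\mapsto\omega(e^t)$ is convex. $K$ and $b$ always denote the constants in ($\alpha$) and ($\gamma$). One extends $\omega$ to $\mathbb{R}^M$ by $\omega(z)=\omega(|z|)$; in particular $\omega(x,\xi)=\omega(|(x,\xi)|)$ on $\mathbb{R}^{2N}$. Fourier transform: $\hat f(\xi)=\int_{\mathbb{R}^N}e^{-ix\xi}f(x)\,dx$. $\mathcal{S}_\omega(\mathbb{R}^M)$ is the set of all $f\in L^1(\mathbb{R}^M)$ with $f,\hat f\in C^\infty(\mathbb{R}^M)$ and $\|e^{\lambda\omega}\partial^\alpha f\|_\infty<\infty$, $\|e^{\lambda\omega}\partial^\alpha\hat f\|_\infty<\infty$ for all $\lambda>0$, $\alpha\in\mathbb{N}_0^M$; it is a Fréchet space with these seminorms, and $\mathcal{S}'_\omega(\mathbb{R}^M)$ is its dual. A condition such as $\|e^{\nu\omega}\sigma\|_q<\infty$ means that $\sigma$ is (given by) a measurable function with $e^{\nu\omega}\sigma\in L^q(\mathbb{R}^{2N})$. Wigner transform: $\mathrm{Wig}(f)(x,\xi)=\int_{\mathbb{R}^N}e^{-it\xi}f(x+\tfrac t2)\overline{f(x-\tfrac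 t2)}\,dt$. Cohen class representation with kernel $\sigma\in\mathcal{S}'_\omega(\mathbb{R}^{2N})$: $Q_\sigma f=\sigma\star\mathrm{Wig}(f)$ (convolution on $\mathbb{R}^{2N}$), $f\in\mathcal{S}_\omega(\mathbb{R}^N)$. Rihaczek form: $Rf(x,\xi)=e^{-ix\xi}f(x)\overline{\hat f(\xi)}$. Short-time Fourier transform: $V_gf(x,\xi)=\int_{\mathbb{R}^N}f(y)\overline{g(y-x)}e^{-iy\xi}\,dy$; spectrogram: $Sp_gf=|V_gf|^2$. $p'$ is the conjugate exponent of $p\in[1,\infty]$; $(2p)'$ is defined by $\frac1{2p}+\frac1{(2p)'}=1$, with $(2p)'=1$ for $p=\infty$. Norms of functions on $\mathbb{R}^N$ are in $L^q(\mathbb{R}^N)$, norms of functions on $\mathbb{R}^{2N}$ are in $L^q(\mathbb{R}^{2N})$. *)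

theory Defs
  imports
    "HOL-Analysis.Analysis"
    "HOL-Probability.Essential_Supremum"
    "HOL-Library.Landau_Symbols"
begin

section \<open>Norms and exponents\<close>

text \<open>Exponents range over the extended nonnegative reals, and norms take values there, so that
  \<open>L_norm q F < \<infinity>\<close> says that a measurable \<open>F\<close> belongs to \<open>L\<^sup>q\<close>.\<close>

definition L_norm :: "ennreal \<Rightarrow> ('a::euclidean_space \<Rightarrow> 'b::real_normed_vector) \<Rightarrow> ennreal" where
  "L_norm q F =
     (if q = \<infinity> then esssup lborel (\<lambda>x. ennreal (norm (F x)))
      else let I = (\<integral>\<^sup>+ x. ennreal (norm (F x) powr enn2real q) \<partial>lborel)
           in if I = \<infinity> then \<infinity> else ennreal (enn2real I powr (1 / enn2real q)))"

text \<open>The norm of \<open>e\<^sup>l\<^sup>\<omega> F\<close> in \<open>L\<^sup>q\<close>, where \<open>\<omega>(z) = \<omega>(|z|)\<close>. On a product type \<open>norm\<close> is the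
  Euclidean norm, so that \<open>\<omega>(x,\<xi>) = \<omega>(|(x,\<xi>)|)\<close>.\<close>

definition weighted_norm ::
  "ennreal \<Rightarrow> (real \<Rightarrow> real) \<Rightarrow> real \<Rightarrow> ('a::euclidean_space \<Rightarrow> 'b::real_normed_vector) \<Rightarrow> ennreal"
where
  "weighted_norm q \<omega> l F = L_norm q (\<lambda>z. exp (l * \<omega> (norm z)) *\<^sub>R F z)"

text \<open>\<open>1/p + 1/p' = 1\<close>, solved for \<open>p'\<close>. In \<^typ>\<open>ennreal\<close> one has \<open>inverse \<infinity> = 0\<close> and
  \<open>inverse 0 = \<infinity>\<close>, so this covers \<open>p = 1\<close> and \<open>p = \<infinity>\<close>.\<close>

definition conj_exponent :: "ennreal \<Rightarrow> ennreal" where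
  "conj_exponent p = inverse (1 - inverse p)"


section \<open>Weight functions\<close>

definition weight_function :: "(real \<Rightarrow> real) \<Rightarrow> real \<Rightarrow> real \<Rightarrow> bool" where
  "weight_function \<omega> K b \<longleftrightarrow>
     continuous_on {0..} \<omega> \<and> mono_on {0..} \<omega> \<and> (\<forall>t\<ge>0. \<omega> t \<ge> 0) \<and>
     K \<ge> 1 \<and> (\<forall>t\<ge>0. \<omega> (2 * t) \<le> K * (1 + \<omega> t)) \<and>
     \<omega> \<in> o[at_top](\<lambda>t. t) \<and>
     b > 0 \<and> (\<exists>a. \<forall>t\<ge>0. \<omega> t \<ge> a + b * ln (1 + t)) \<and>
     convex_on UNIV (\<lambda>t. \<omega> (exp t))"


section \<open>The space of test functions and its dual\<close>

definition partial_deriv :: "'a::euclidean_space \<Rightarrow> ('a \<Rightarrow> complex) \<Rightarrow> 'a \<Rightarrow> complex" where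
  "partial_deriv i f = (\<lambda>x. frechet_derivative f (at x) i)"

text \<open>The partial derivatives \<open>\<partial>\<^sup>\<alpha> f\<close> are encoded by the finite sequence of coordinate directions
  in which one differentiates. For \<open>C\<^sup>\<infinity>\<close> functions the order is irrelevant, so the sequences give
  exactly the derivatives with respect to multi-indices.\<close>

definition iterated_deriv :: "'a::euclidean_space list \<Rightarrow> ('a \<Rightarrow> complex) \<Rightarrow> 'a \<Rightarrow> complex" where
  "iterated_deriv bs f = foldr partial_deriv bs f"

definition smooth :: "('a::euclidean_space \<Rightarrow> complex) \<Rightarrow> bool" where
  "smooth f \<longleftrightarrow> (\<forall>bs \<in> lists Basis. iterated_deriv bs f differentiable_on UNIV)"

definition fourier :: "('a::euclidean_space \<Rightarrow> complex) \<Rightarrow> 'a \<Rightarrow> complex" where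
  "fourier f \<xi> = (LINT x|lborel. cis (- (x \<bullet> \<xi>)) * f x)"

definition S_space :: "(real \<Rightarrow> real) \<Rightarrow> ('a::euclidean_space \<Rightarrow> complex) set" where
  "S_space \<omega> =
     {f. integrable lborel f \<and> smooth f \<and> smooth (fourier f) \<and>
         (\<forall>l>0. \<forall>bs \<in> lists Basis.
            weighted_norm \<infinity> \<omega> l (iterated_deriv bs f) < \<infinity> \<and>
            weighted_norm \<infinity> \<omega> l (iterated_deriv bs (fourier f)) < \<infinity>)}"

text \<open>The locally convex topology given by the two families of seminorms: it is generated by the
  open balls of the individual seminorms.\<close>

definition S_topology :: "(real \<Rightarrow> real) \<Rightarrow> ('a::euclidean_space \<Rightarrow> complex) topology" where
  "S_topology \<omega> = topology_generated_by
     ({{f \<in> S_space \<omega>. weighted_norm \<infinity> \<omega> l (iterated_deriv bs (\<lambda>x. f x - h x)) < ennreal \<epsilon>}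
        | l bs h \<epsilon>. l > 0 \<and> bs \<in> lists Basis \<and> h \<in> S_space \<omega> \<and> \<epsilon> > 0} \<union>
      {{f \<in> S_space \<omega>. weighted_norm \<infinity> \<omega> l (iterated_deriv bs (fourier (\<lambda>x. f x - h x))) < ennreal \<epsilon>}
        | l bs h \<epsilon>. l > 0 \<and> bs \<in> lists Basis \<and> h \<in> S_space \<omega> \<and> \<epsilon> > 0})"

definition S_dual :: "(real \<Rightarrow> real) \<Rightarrow> (('a::euclidean_space \<Rightarrow> complex) \<Rightarrow> complex) set" where
  "S_dual \<omega> =
     {T. (\<forall>f \<in> S_space \<omega>. \<forall>g \<in> S_space \<omega>. T (\<lambda>x. f x + g x) = T f + T g) \<and>
         (\<forall>c. \<forall>f \<in> S_space \<omega>. T (\<lambda>x. c * f x) = c * T f) \<and>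
         continuous_map (S_topology \<omega>) euclidean T}"

text \<open>The functional \<open>\<phi> \<mapsto> \<integral> \<sigma> \<phi>\<close> given by a measurable function \<open>\<sigma>\<close>. Functionals are total
  functions here; an element of the dual space is determined by its values on \<^term>\<open>S_space \<omega>\<close>.\<close>

definition functional_of :: "('a::euclidean_space \<Rightarrow> complex) \<Rightarrow> ('a \<Rightarrow> complex) \<Rightarrow> complex" where
  "functional_of \<sigma> = (\<lambda>\<phi>. LINT w|lborel. \<sigma> w * \<phi> w)"

text \<open>The convolution of a functional with a test function, \<open>(T \<star> \<phi>)(z) = \<langle>T, \<phi>(z - \<cdot>)\<rangle>\<close>. For
  \<open>T = functional_of \<sigma>\<close> it is the usual \<open>\<integral> \<sigma>(w) \<phi>(z - w) dw\<close>.\<close>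

definition convolution ::
  "(('a::euclidean_space \<Rightarrow> complex) \<Rightarrow> complex) \<Rightarrow> ('a \<Rightarrow> complex) \<Rightarrow> 'a \<Rightarrow> complex"
where
  "convolution T \<phi> z = T (\<lambda>w. \<phi> (z - w))"


section \<open>Time-frequency representations\<close>

definition Wig :: "('a::euclidean_space \<Rightarrow> complex) \<Rightarrow> 'a \<times> 'a \<Rightarrow> complex" where
  "Wig f = (\<lambda>(x, \<xi>). LINT t|lborel.
     cis (- (t \<bullet> \<xi>)) * f (x + (1/2) *\<^sub>R t) * cnj (f (x - (1/2) *\<^sub>R t)))"

definition Cohen ::
  "(('a::euclidean_space \<times> 'a \<Rightarrow> complex) \<Rightarrow> complex) \<Rightarrow> ('a \<Rightarrow> complex) \<Rightarrow> 'a \<times> 'a \<Rightarrow> complex"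
where
  "Cohen T f = convolution T (Wig f)"

definition Rihaczek :: "('a::euclidean_space \<Rightarrow> complex) \<Rightarrow> 'a \<times> 'a \<Rightarrow> complex" where
  "Rihaczek f = (\<lambda>(x, \<xi>). cis (- (x \<bullet> \<xi>)) * f x * cnj (fourier f \<xi>))"

definition STFT ::
  "('a::euclidean_space \<Rightarrow> complex) \<Rightarrow> ('a \<Rightarrow> complex) \<Rightarrow> 'a \<times> 'a \<Rightarrow> complex"
where
  "STFT g f = (\<lambda>(x, \<xi>). LINT y|lborel. f y * cnj (g (y - x)) * cis (- (y \<bullet> \<xi>)))"

definition spectrogram ::
  "('a::euclidean_space \<Rightarrow> complex) \<Rightarrow> ('a \<Rightarrow> complex) \<Rightarrow> 'a \<times> 'a \<Rightarrow> real"
where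
  "spectrogram g f z = (cmod (STFT g f z))\<^sup>2"


section \<open>The constants of the estimates\<close>

text \<open>Here \<open>N\<close> is \<open>DIM('a)\<close>.\<close>

definition D6 ::
  "(real \<Rightarrow> real) \<Rightarrow> real \<Rightarrow> real \<Rightarrow> ennreal \<Rightarrow> ('a::euclidean_space \<Rightarrow> complex) \<Rightarrow> real \<Rightarrow> real \<Rightarrow> ennreal"
where
  "D6 \<omega> K b p g s \<mu> =
     ennreal (2 ^ DIM('a) * exp (K / 2 * (1 + 2 * K) * s)) /
       (ennreal ((2 * pi) powr (5 / 2 * DIM('a))) * L_norm 2 g ^ 4) *
     (INF (\<mu>1, \<mu>2) \<in> {(\<mu>1, \<mu>2). 2 * (K\<^sup>2 * \<mu>1 + \<mu>2) = \<mu> \<and> \<mu>1 > DIM('a) / b \<and>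
                         \<mu>2 > 2 * DIM('a) / (b * enn2real (conj_exponent (2 * p)))}.
        ennreal (exp (K * (1 + 2 * K) * (4 * K\<^sup>2 * s + \<mu>1))) *
        weighted_norm \<infinity> \<omega> (K\<^sup>2 * (4 * K\<^sup>2 * s + \<mu>1)) g *
        weighted_norm \<infinity> \<omega> (K\<^sup>2 * (4 * K\<^sup>2 * s + \<mu>1)) (fourier g) *
        L_norm 2 (\<lambda>z :: 'a \<times> 'a. exp (- \<mu>1 * \<omega> (norm z))) *
        (L_norm (conj_exponent (2 * p)) (\<lambda>z :: 'a \<times> 'a. exp (- \<mu>2 * \<omega> (norm z))))\<^sup>2)"

definition D9 ::
  "(real \<Rightarrow> real) \<Rightarrow> real \<Rightarrow> ennreal \<Rightarrow> ('a::euclidean_space \<times> 'a \<Rightarrow> complex) \<Rightarrow> real \<Rightarrow> ennreal"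
where
  "D9 \<omega> K p \<sigma> l = ennreal (exp (K * l)) * weighted_norm (conj_exponent p) \<omega> (K * l) \<sigma>"

definition D10 ::
  "(real \<Rightarrow> real) \<Rightarrow> real \<Rightarrow> ('a::euclidean_space \<times> 'a \<Rightarrow> complex) \<Rightarrow> real \<Rightarrow> ennreal"
where
  "D10 \<omega> K \<sigma> l =
     ennreal ((4 / (2 * pi)) ^ DIM('a) * exp (K * (2 + K + 2 * K\<^sup>2) * l)) *
     (weighted_norm 1 \<omega> (K * l) \<sigma>)\<^sup>2"

definition D11 ::
  "(real \<Rightarrow> real) \<Rightarrow> real \<Rightarrow> real \<Rightarrow> ennreal \<Rightarrow> ('a::euclidean_space \<Rightarrow> complex) \<Rightarrow>
   ('a \<times> 'a \<Rightarrow> complex) \<Rightarrow> real \<Rightarrow> real \<Rightarrow> ennreal"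
where
  "D11 \<omega> K b p g \<sigma> l \<mu> =
     ennreal (exp (K * l)) * D6 \<omega> K b p g (K * l) \<mu> * weighted_norm 1 \<omega> (K * l) \<sigma>"

end

theory Submission
  imports "HOL-Probability.Characteristic_Functions" Defs
begin

text \<open>Since \<open>\<omega>(z) \<le> K(1 + \<omega>(w) + \<omega>(z - w))\<close>, the weight can be distributed over the two factors of
  a convolution, and Hoelder's inequality gives (i). For (ii) and (iii) one applies (i) with \<open>L\<^sup>1\<close> and
  \<open>L\<^sup>\<infinity>\<close>, so that a uniform bound of the weighted \<open>Wig f\<close> is needed.

  Both \<open>Wig f\<close> and \<open>V\<^sub>g f\<close> are, up to phase factors and dilations, convolutions of modulations of \<open>f\<close>
  with reflections of \<open>f\<close> or \<open>g\<close>, and the only inversion result needed is that \<open>(2\<pi>)\<^sup>N |h(y)|\<close> is at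
  most the \<open>L\<^sup>1\<close> norm of the Fourier transform of \<open>h\<close>, applied to such convolutions.
  Thus \<open>|Wig f(x,\<xi>)|\<close> is bounded by \<open>2\<^sup>N \<integral> |f(u)| |f(2x - u)| du\<close> and by the same integral for the
  Fourier transform at \<open>\<xi>\<close>, divided by \<open>(2\<pi>)\<^sup>N\<close>. As \<open>x\<close> is the midpoint of \<open>u\<close> and \<open>2x - u\<close>, one has
  \<open>\<omega>(x) \<le> \<omega>(u) + \<omega>(2x - u)\<close>, and the product of the two bounds gives (ii).

  For (iii), (ii) with \<open>p = 2\<close> reduces the claim to a weighted \<open>L\<^sup>\<infinity>\<close> bound of \<open>Rf\<close>, hence of \<open>f\<close> and
  its Fourier transform, and these are recovered from \<open>V\<^sub>g f\<close> by integrating it against \<open>g\<close> and the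
  Fourier transform of \<open>g\<close>.\<close>


section \<open>Changes of variables in Lebesgue integrals\<close>

lemma nn_integral_lborel_affine:
  fixes f :: "'a::euclidean_space \<Rightarrow> ennreal"
  assumes [measurable]: "f \<in> borel_measurable borel" and c: "c \<noteq> 0"
  shows "(\<integral>\<^sup>+x. f x \<partial>lborel) = ennreal (\<bar>c\<bar> ^ DIM('a)) * (\<integral>\<^sup>+x. f (t + c *\<^sub>R x) \<partial>lborel)"
  by (subst lborel_affine[OF c, of t])
     (simp add: nn_integral_density nn_integral_distr nn_integral_cmult)

lemma integral_lborel_affine:
  fixes f :: "'a::euclidean_space \<Rightarrow> 'b::{banach, second_countable_topology}"
  assumes [measurable]: "f \<in> borel_measurable borel" and c: "c \<noteq> 0"
  shows "(LINT x|lborel. f x) = \<bar>c\<bar> ^ DIM('a) *\<^sub>R (LINT x|lborel. f (t + c *\<^sub>R x))"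
  by (subst lborel_affine[OF c, of t])
     (simp add: integral_density integral_distr)

lemma integrable_lborel_affine:
  fixes f :: "'a::euclidean_space \<Rightarrow> 'b::{banach, second_countable_topology}"
  assumes f: "integrable lborel f" and c: "c \<noteq> 0"
  shows "integrable lborel (\<lambda>x. f (t + c *\<^sub>R x))"
  using f f[THEN borel_measurable_integrable] c unfolding integrable_iff_bounded
  by (subst (asm) nn_integral_lborel_affine[where c=c and t=t]) (auto simp: ennreal_mult_less_top)

lemma AE_lborel_affine:
  fixes P :: "'a::euclidean_space \<Rightarrow> bool"
  assumes c: "c \<noteq> 0" and [measurable]: "Measurable.pred borel P" and P: "AE x in lborel. P x"
  shows "AE x in lborel. P (t + c *\<^sub>R x)"
  using P c
  \<comment> \<open>The measure is written as a multiple of its image under the inverse map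
    \<open>x \<mapsto> (x - t) / c\<close>, which cancels the affine map inside
    \<open>P\<close>.\<close>
  by (subst lborel_affine[where t="- (1/c) *\<^sub>R t" and c="1 / c"])
     (simp_all add: AE_density AE_distr_iff algebra_simps)

lemma nn_integral_lborel_reflect:
  fixes f :: "'a::euclidean_space \<Rightarrow> ennreal"
  assumes "f \<in> borel_measurable borel"
  shows "(\<integral>\<^sup>+x. f (z - x) \<partial>lborel) = (\<integral>\<^sup>+x. f x \<partial>lborel)"
  using nn_integral_lborel_affine[OF assms, of "-1" z] by simp

lemma integral_lborel_reflect:
  fixes f :: "'a::euclidean_space \<Rightarrow> 'b::{banach, second_countable_topology}"
  assumes "f \<in> borel_measurable borel"
  shows "(LINT x|lborel. f (z - x)) = (LINT x|lborel. f x)"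
  using integral_lborel_affine[OF assms, of "-1" z] by simp

lemma integrable_lborel_reflect:
  fixes f :: "'a::euclidean_space \<Rightarrow> 'b::{banach, second_countable_topology}"
  assumes "integrable lborel f"
  shows "integrable lborel (\<lambda>x. f (z - x))"
  using integrable_lborel_affine[OF assms, of "-1" z] by simp

text \<open>Where \<open>f\<close> is not integrable, its Bochner integral has the default value 0
  and the left side vanishes. This gives bounds for \<open>fourier\<close>, \<open>convol\<close>
  and \<open>convolution\<close> before any integrability is known.\<close>

lemma norm_integral_le_nn_integral:
  fixes f :: "'a \<Rightarrow> 'b::{banach, second_countable_topology}"
  shows "ennreal (norm (LINT x|M. f x)) \<le> (\<integral>\<^sup>+x. ennreal (norm (f x)) \<partial>M)"
  by (cases "integrable M f") (simp_all add: integral_norm_bound_ennreal not_integrable_integral_eq)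


section \<open>The norms of \<open>L\<^sup>p\<close>\<close>

text \<open>The outer step in \<open>L_norm\<close> for finite exponents, isolated so that
  monotonicity and multiplicativity can be used on infinite integrals too. The case \<infinity> is
  separate because \<open>enn2real \<infinity>\<close> is 0.\<close>

definition root_ennreal :: "real \<Rightarrow> ennreal \<Rightarrow> ennreal" where
  "root_ennreal r I = (if I = \<infinity> then \<infinity> else ennreal (enn2real I powr (1 / r)))"

lemma L_norm_top: "L_norm top F = esssup lborel (\<lambda>x. ennreal (norm (F x)))"
  by (simp add: L_norm_def)

lemma L_norm_finite:
  "q \<noteq> \<infinity> \<Longrightarrow> L_norm q F =
     root_ennreal (enn2real q) (\<integral>\<^sup>+ x. ennreal (norm (F x) powr enn2real q) \<partial>lborel)"
  by (simp add: L_norm_def root_ennreal_def Let_def)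

lemma root_ennreal_mono:
  assumes "I \<le> J" "r > 0" shows "root_ennreal r I \<le> root_ennreal r J"
proof (cases "J = \<infinity>")
  case False
  then have "I \<noteq> \<infinity>" using assms by (auto simp: top_unique)
  with False assms show ?thesis
    by (auto simp: root_ennreal_def less_top intro!: ennreal_leI powr_mono2 enn2real_mono)
qed (simp add: root_ennreal_def)

lemma root_ennreal_mult: "r > 0 \<Longrightarrow> root_ennreal r (I * J) = root_ennreal r I * root_ennreal r J"
  by (cases I; cases J)
     (auto simp: root_ennreal_def ennreal_mult_eq_top_iff ennreal_top_mult ennreal_mult_top
        ennreal_mult[symmetric] powr_mult)

lemma root_ennreal_powr: "r > 0 \<Longrightarrow> c \<ge> 0 \<Longrightarrow> root_ennreal r (ennreal (c powr r)) = ennreal c"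
  by (auto simp: root_ennreal_def powr_powr)

lemma root_ennreal_eq_0: "root_ennreal r I = 0 \<longleftrightarrow> I = 0"
  by (cases I) (auto simp: root_ennreal_def)

lemma root_ennreal_one: "root_ennreal 1 I = I"
  by (cases I) (auto simp: root_ennreal_def)

lemma L_norm_one: "L_norm 1 F = (\<integral>\<^sup>+ x. ennreal (norm (F x)) \<partial>lborel)"
  by (simp add: L_norm_finite root_ennreal_one)

lemma exponent_real:
  assumes "(1::ennreal) \<le> q" "q \<noteq> \<infinity>"
  shows "1 \<le> enn2real q" "q = ennreal (enn2real q)"
proof -
  show "q = ennreal (enn2real q)" using assms by (simp add: less_top)
  show "1 \<le> enn2real q"
    using enn2real_mono[of 1 q] assms by (simp add: less_top)
qed

lemma L_norm_mono:
  fixes F :: "'a::euclidean_space \<Rightarrow> 'b::real_normed_vector"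
    and G :: "'a \<Rightarrow> 'c::real_normed_vector"
  assumes q: "1 \<le> q" and [measurable]: "(\<lambda>x. norm (F x)) \<in> borel_measurable borel"
      "(\<lambda>x. norm (G x)) \<in> borel_measurable borel"
    and C: "0 \<le> C" and le: "AE x in lborel. norm (F x) \<le> C * norm (G x)"
  shows "L_norm q F \<le> ennreal C * L_norm q G"
proof (cases "q = \<infinity>")
  case True
  have "AE x in lborel. ennreal (norm (F x)) \<le> ennreal C * esssup lborel (\<lambda>x. ennreal (norm (G x)))"
    using le esssup_AE[of "\<lambda>x. ennreal (norm (G x))" lborel]
  proof eventually_elim
    case (elim x)
    have "ennreal (norm (F x)) \<le> ennreal C * ennreal (norm (G x))"
      using elim C by (simp add: ennreal_mult[symmetric])
    also have "\<dots> \<le> ennreal C * esssup lborel (\<lambda>x. ennreal (norm (G x)))"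
      using elim by (intro mult_left_mono) auto
    finally show ?case .
  qed
  then show ?thesis using True by (auto simp: L_norm_top intro!: esssup_I)
next
  case False
  note r = exponent_real[OF q False]
  let ?r = "enn2real q"
  have "(\<integral>\<^sup>+ x. ennreal (norm (F x) powr ?r) \<partial>lborel)
      \<le> (\<integral>\<^sup>+ x. ennreal (C powr ?r) * ennreal (norm (G x) powr ?r) \<partial>lborel)"
  proof (rule nn_integral_mono_AE, use le in eventually_elim)
    case (elim x)
    have "norm (F x) powr ?r \<le> (C * norm (G x)) powr ?r"
      using elim r by (intro powr_mono2) auto
    then show ?case using C by (simp add: ennreal_mult[symmetric] powr_mult)
  qed
  also have "\<dots> = ennreal (C powr ?r) * (\<integral>\<^sup>+ x. ennreal (norm (G x) powr ?r) \<partial>lborel)"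
    by (intro nn_integral_cmult) measurable
  finally have "root_ennreal ?r (\<integral>\<^sup>+ x. ennreal (norm (F x) powr ?r) \<partial>lborel)
    \<le> root_ennreal ?r (ennreal (C powr ?r) * (\<integral>\<^sup>+ x. ennreal (norm (G x) powr ?r) \<partial>lborel))"
    using r by (intro root_ennreal_mono) auto
  then show ?thesis using r C False
    by (simp add: L_norm_finite root_ennreal_mult root_ennreal_powr)
qed

lemma L_norm_reflect:
  fixes F :: "'a::euclidean_space \<Rightarrow> 'b::real_normed_vector"
  assumes q: "1 \<le> q" and [measurable]: "(\<lambda>x. norm (F x)) \<in> borel_measurable borel"
  shows "L_norm q (\<lambda>x. F (z - x)) \<le> L_norm q F"
proof (cases "q = \<infinity>")
  case True
  have "AE x in lborel. ennreal (norm (F (z + (-1) *\<^sub>R x))) \<le> esssup lborel (\<lambda>x. ennreal (norm (F x)))"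
    by (rule AE_lborel_affine) (auto intro: esssup_AE)
  then have "esssup lborel (\<lambda>x. ennreal (norm (F (z - x)))) \<le> esssup lborel (\<lambda>x. ennreal (norm (F x)))"
    by (intro esssup_I) auto
  then show ?thesis using True by (simp add: L_norm_top)
next
  case False
  show ?thesis using False
      nn_integral_lborel_reflect[of "\<lambda>x. ennreal (norm (F x) powr enn2real q)" z]
    by (simp add: L_norm_finite)
qed

lemma L_norm_eq_0_AE:
  fixes F :: "'a::euclidean_space \<Rightarrow> 'b::real_normed_vector"
  assumes q: "1 \<le> q" and [measurable]: "(\<lambda>x. norm (F x)) \<in> borel_measurable borel"
    and z: "L_norm q F = 0"
  shows "AE x in lborel. F x = 0"
proof (cases "q = \<infinity>")
  case True
  then show ?thesis
    using z esssup_AE[of "\<lambda>x. ennreal (norm (F x))" lborel] by (simp add: L_norm_top)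
next
  case False
  note r = exponent_real[OF q False]
  have "(\<integral>\<^sup>+ x. ennreal (norm (F x) powr enn2real q) \<partial>lborel) = 0"
    using z False by (simp add: L_norm_finite root_ennreal_eq_0)
  then have "AE x in lborel. ennreal (norm (F x) powr enn2real q) = 0"
    by (subst (asm) nn_integral_0_iff_AE) auto
  then show ?thesis by eventually_elim (use r in auto)
qed

section \<open>Conjugate exponents and Hoelder's inequality\<close>

lemma conj_exponent_real:
  assumes "1 < r"
  shows "conj_exponent (ennreal r) = ennreal (r / (r - 1))"
proof -
  have "conj_exponent (ennreal r) = inverse (1 - ennreal (1 / r))"
    using assms by (simp add: conj_exponent_def inverse_ennreal inverse_eq_divide)
  also have "1 - ennreal (1 / r) = ennreal (1 - 1 / r)"
    using assms by (simp flip: ennreal_1 add: ennreal_minus)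
  also have "inverse \<dots> = ennreal (r / (r - 1))"
    using assms by (subst inverse_ennreal) (auto simp: field_simps)
  finally show ?thesis .
qed

lemma conj_exponent_one [simp]: "conj_exponent 1 = top"
  by (simp add: conj_exponent_def)

lemma conj_exponent_top [simp]: "conj_exponent top = 1"
  by (simp add: conj_exponent_def)

lemma conj_exponent_ge_1: "1 \<le> conj_exponent p"
proof -
  have "1 - inverse p \<le> 1" by (simp add: ennreal_minus_le_iff)
  then show ?thesis
    by (cases "1 - inverse p"; cases "1 - inverse p = 0")
       (auto simp: conj_exponent_def inverse_ennreal one_le_inverse_iff less_le
          simp flip: ennreal_1 intro!: ennreal_leI)
qed

lemma nn_integral_mult_esssup:
  fixes F :: "'a::euclidean_space \<Rightarrow> 'b::real_normed_vector"
    and G :: "'a \<Rightarrow> 'c::real_normed_vector"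
  assumes [measurable]: "(\<lambda>x. norm (F x)) \<in> borel_measurable borel"
      "(\<lambda>x. norm (G x)) \<in> borel_measurable borel"
  shows "(\<integral>\<^sup>+ x. ennreal (norm (F x) * norm (G x)) \<partial>lborel) \<le> L_norm 1 F * L_norm top G"
proof -
  have "(\<integral>\<^sup>+ x. ennreal (norm (F x) * norm (G x)) \<partial>lborel)
     \<le> (\<integral>\<^sup>+ x. ennreal (norm (F x)) * L_norm top G \<partial>lborel)"
    using esssup_AE[of "\<lambda>x. ennreal (norm (G x))" lborel]
    by (intro nn_integral_mono_AE)
       (auto simp: L_norm_top ennreal_mult intro!: mult_left_mono elim!: eventually_mono)
  also have "\<dots> = L_norm 1 F * L_norm top G"
    by (subst nn_integral_multc) (auto simp: L_norm_one)
  finally show ?thesis .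
qed

lemma root_ennreal_pos_finite:
  assumes "r > 0" "I \<noteq> 0" "I \<noteq> \<infinity>"
  obtains a where "a > 0" "root_ennreal r I = ennreal a" "I = ennreal (a powr r)"
proof (rule that)
  show "enn2real I powr (1 / r) > 0" using assms by (auto simp: enn2real_eq_0_iff)
  show "root_ennreal r I = ennreal (enn2real I powr (1 / r))"
    using assms by (simp add: root_ennreal_def)
  show "I = ennreal ((enn2real I powr (1 / r)) powr r)"
    using assms by (simp add: powr_powr less_top)
qed

text \<open>For exponents strictly between 1 and \<infinity> both functions are divided by their
  norms, Young's inequality is applied pointwise, and the result is integrated. The endpoints use
  the bound by the essential supremum.\<close>

lemma Hoelder_L_norm:
  fixes F :: "'a::euclidean_space \<Rightarrow> 'b::real_normed_vector"
    and G :: "'a \<Rightarrow> 'c::real_normed_vector"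
  assumes p: "1 \<le> p" and [measurable]: "(\<lambda>x. norm (F x)) \<in> borel_measurable borel"
      "(\<lambda>x. norm (G x)) \<in> borel_measurable borel"
  shows "(\<integral>\<^sup>+ x. ennreal (norm (F x) * norm (G x)) \<partial>lborel)
    \<le> L_norm p F * L_norm (conj_exponent p) G"
proof -
  consider "p = 1" | "p = \<infinity>" | "1 < p" "p \<noteq> \<infinity>" using p by fastforce
  then show ?thesis
  proof cases
    case 1
    then show ?thesis using nn_integral_mult_esssup[of F G] by simp
  next
    case 2
    then show ?thesis using nn_integral_mult_esssup[of G F] by (simp add: mult.commute)
  next
    case 3
    define r where "r = enn2real p"
    define s where "s = r / (r - 1)"
    have pr: "p = ennreal r" using exponent_real[OF p] 3 by (simp add: r_def)
    have r: "r > 1" using 3(1) ennreal_less_iff[of 1 r] unfolding pr by simp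
    have s: "s > 1" and rs: "1 / r + 1 / s = 1" using r by (auto simp: s_def field_simps)
    have cs: "conj_exponent p = ennreal s" using r by (simp add: pr s_def conj_exponent_real)
    let ?A = "\<integral>\<^sup>+ x. ennreal (norm (F x) powr r) \<partial>lborel"
    let ?B = "\<integral>\<^sup>+ x. ennreal (norm (G x) powr s) \<partial>lborel"
    have LF: "L_norm p F = root_ennreal r ?A" using r by (simp add: pr L_norm_finite)
    have LG: "L_norm (conj_exponent p) G = root_ennreal s ?B"
      using s by (simp add: cs L_norm_finite)
    \<comment> \<open>Normalisation needs norms that are positive and finite. A zero norm makes the
      integrand vanish almost everywhere; an infinite integral next to a nonzero norm makes the
      right side \<infinity>.\<close>
    consider "L_norm p F = 0" | "L_norm (conj_exponent p) G = 0"
      | "?A = \<infinity>" "L_norm (conj_exponent p) G \<noteq> 0" | "?B = \<infinity>" "L_norm p F \<noteq> 0"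
      | "?A \<noteq> 0" "?A \<noteq> \<infinity>" "?B \<noteq> 0" "?B \<noteq> \<infinity>"
      by (auto simp: LF LG root_ennreal_eq_0)
    then show ?thesis
    proof cases
      case 1
      have "AE x in lborel. ennreal (norm (F x) * norm (G x)) = 0"
        using L_norm_eq_0_AE[OF p _ 1] by auto
      then have "(\<integral>\<^sup>+ x. ennreal (norm (F x) * norm (G x)) \<partial>lborel) = (\<integral>\<^sup>+ x. 0 \<partial>(lborel :: 'a measure))"
        by (rule nn_integral_cong_AE)
      then show ?thesis by simp
    next
      case 2
      have "AE x in lborel. ennreal (norm (F x) * norm (G x)) = 0"
        using L_norm_eq_0_AE[OF conj_exponent_ge_1 _ 2] by auto
      then have "(\<integral>\<^sup>+ x. ennreal (norm (F x) * norm (G x)) \<partial>lborel) = (\<integral>\<^sup>+ x. 0 \<partial>(lborel :: 'a measure))"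
        by (rule nn_integral_cong_AE)
      then show ?thesis by simp
    next
      case 3
      then show ?thesis by (simp add: LF root_ennreal_def ennreal_top_mult)
    next
      case 4
      then show ?thesis by (simp add: LG root_ennreal_def ennreal_mult_top)
    next
      case 5
      obtain a where a: "a > 0" "root_ennreal r ?A = ennreal a" "?A = ennreal (a powr r)"
        using root_ennreal_pos_finite[of r ?A] 5 r by auto
      obtain b where b: "b > 0" "root_ennreal s ?B = ennreal b" "?B = ennreal (b powr s)"
        using root_ennreal_pos_finite[of s ?B] 5 s by auto
      \<comment> \<open>Young's inequality for \<open>norm (F x) / a\<close> and
        \<open>norm (G x) / b\<close>, multiplied by \<open>a * b\<close>. Since the integrals of
        the powers are \<open>a powr r\<close> and \<open>b powr s\<close>, integration yields
        \<open>a * b / r + a * b / s = a * b\<close>.\<close>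
      have young: "norm (F x) * norm (G x)
          \<le> (a * b / (r * a powr r)) * norm (F x) powr r + (a * b / (s * b powr s)) * norm (G x) powr s" for x
      proof -
        have "(norm (F x) / a) * (norm (G x) / b)
            \<le> (norm (F x) / a) powr r / r + (norm (G x) / b) powr s / s"
          using Youngs_inequality[of r s "norm (F x) / a" "norm (G x) / b"] r s rs a b by auto
        then have "(a * b) * ((norm (F x) / a) * (norm (G x) / b))
            \<le> (a * b) * ((norm (F x) / a) powr r / r + (norm (G x) / b) powr s / s)"
          using a b by (intro mult_left_mono) auto
        then show ?thesis using a b r s by (simp add: powr_divide field_simps)
      qed
      have "(\<integral>\<^sup>+ x. ennreal (norm (F x) * norm (G x)) \<partial>lborel)
        \<le> (\<integral>\<^sup>+ x. ennreal (a * b / (r * a powr r)) * ennreal (norm (F x) powr r)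
               + ennreal (a * b / (s * b powr s)) * ennreal (norm (G x) powr s) \<partial>lborel)"
        using young r s a b
        by (intro nn_integral_mono) (auto simp: ennreal_mult[symmetric] ennreal_plus[symmetric]
              simp del: ennreal_plus intro!: ennreal_leI)
      also have "\<dots> = ennreal (a * b / (r * a powr r)) * ?A + ennreal (a * b / (s * b powr s)) * ?B"
        by (simp add: nn_integral_add nn_integral_cmult)
      also have "\<dots> = ennreal (a * b * (1 / r) + a * b * (1 / s))"
        unfolding a(3) b(3) using a b r s by (simp add: ennreal_mult[symmetric] ennreal_plus[symmetric] del: ennreal_plus)
      also have "\<dots> = ennreal a * ennreal b"
        using a b rs by (simp add: ennreal_mult[symmetric] distrib_left[symmetric] del: times_divide_eq_right mult_1_right)
      finally show ?thesis by (simp only: LF LG a(2) b(2))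
    qed
  qed
qed

section \<open>Norms of tensor products and of squares\<close>

lemma L_norm_tensor:
  fixes F :: "'a::euclidean_space \<Rightarrow> 'b::real_normed_vector"
    and G :: "'c::euclidean_space \<Rightarrow> 'd::real_normed_vector"
  assumes q: "1 \<le> q" and [measurable]: "(\<lambda>x. norm (F x)) \<in> borel_measurable borel"
      "(\<lambda>x. norm (G x)) \<in> borel_measurable borel"
  shows "L_norm q F * L_norm q G \<le> L_norm q (\<lambda>(x, y). norm (F x) * norm (G y))"
proof (cases "q = \<infinity>")
  case True
  define c where "c = L_norm top (\<lambda>(x, y). norm (F x) * norm (G y))"
  have "AE z in lborel \<Otimes>\<^sub>M lborel. ennreal (norm (F (fst z)) * norm (G (snd z))) \<le> c"
    using esssup_AE[of "\<lambda>z. ennreal (norm (case z of (x, y) \<Rightarrow> norm (F x) * norm (G y)))"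
        "lborel :: ('a \<times> 'c) measure"]
    unfolding lborel_prod by (simp add: c_def L_norm_top case_prod_beta)
  then have ae: "AE x in lborel. AE y in lborel. ennreal (norm (F x) * norm (G y)) \<le> c"
    using lborel_pair.AE_pair[of "\<lambda>z. ennreal (norm (F (fst z)) * norm (G (snd z))) \<le> c"] by simp
  \<comment> \<open>For almost every \<open>x\<close> the factor \<open>norm (F x)\<close> is a
    constant \<open>u\<close> on the slice, and division by it takes it out of the essential
    supremum in \<open>y\<close>.\<close>
  have scale: "ennreal u * esssup lborel (\<lambda>y. ennreal (v y)) \<le> c"
    if [measurable]: "v \<in> borel_measurable borel" and nn: "\<And>y. v y \<ge> 0" "u \<ge> 0"
      and *: "AE y in lborel. ennreal (u * v y) \<le> c"
    for u and v :: "'c \<Rightarrow> real"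
  proof (cases "u = 0")
    case False
    have "AE y in lborel. ennreal (v y) \<le> c / ennreal u" using *
    proof eventually_elim
      case (elim y)
      have "ennreal (v y) = ennreal (u * v y) / ennreal u"
        using nn False by (subst divide_ennreal) auto
      also have "\<dots> \<le> c / ennreal u" using elim by (rule divide_right_mono_ennreal)
      finally show ?case .
    qed
    then have "esssup lborel (\<lambda>y. ennreal (v y)) \<le> c / ennreal u" by (intro esssup_I) auto
    then have "ennreal u * esssup lborel (\<lambda>y. ennreal (v y)) \<le> ennreal u * (c / ennreal u)"
      by (rule mult_left_mono) auto
    also have "\<dots> = c" using False nn by (simp add: ennreal_times_divide mult_divide_eq_ennreal mult.commute)
    finally show ?thesis .
  qed auto
  have ae2: "AE x in lborel. ennreal (norm (F x)) * L_norm top G \<le> c"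
    using ae by eventually_elim (auto simp: L_norm_top intro!: scale)
  have "L_norm top F * L_norm top G \<le> c"
  \<comment> \<open>The same division in \<open>x\<close>. If \<open>L_norm top G\<close> is
    \<infinity> while \<open>c\<close> is finite, then \<open>F\<close> must vanish almost
    everywhere, and 0 * \<infinity> = 0 closes the case.\<close>
  proof (cases "L_norm top G = 0 \<or> c = top")
    case False
    show ?thesis
    proof (cases "L_norm top G = top")
      case True
      have "AE x in lborel. ennreal (norm (F x)) = 0"
        using ae2 by eventually_elim (use True False in \<open>auto simp: ennreal_mult_top top_unique split: if_splits\<close>)
      then have "L_norm top F \<le> 0" unfolding L_norm_top by (intro esssup_I) auto
      then show ?thesis by simp
    next
      case top: False
      have "AE x in lborel. ennreal (norm (F x)) \<le> c / L_norm top G" using ae2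
      proof eventually_elim
        case (elim x)
        have "ennreal (norm (F x)) = ennreal (norm (F x)) * L_norm top G / L_norm top G"
          using top False by (subst mult_divide_eq_ennreal) auto
        also have "\<dots> \<le> c / L_norm top G" using elim by (rule divide_right_mono_ennreal)
        finally show ?case .
      qed
      then have "L_norm top F \<le> c / L_norm top G" unfolding L_norm_top[of F] by (intro esssup_I) auto
      then have "L_norm top F * L_norm top G \<le> c / L_norm top G * L_norm top G" by (rule mult_right_mono) auto
      also have "\<dots> = c" using top False 
        by (cases c; cases "L_norm top G") (auto simp: divide_ennreal ennreal_mult[symmetric])
      finally show ?thesis .
    qed
  qed auto
  then show ?thesis using True by (simp add: c_def)
next
  case False
  note r = exponent_real[OF q False]
  let ?r = "enn2real q"
  have "(\<integral>\<^sup>+ z. ennreal (norm (case z of (x, y) \<Rightarrow> norm (F x) * norm (G y)) powr ?r) \<partial>lborel)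
     = (\<integral>\<^sup>+ x. \<integral>\<^sup>+ y. ennreal (norm (F x) powr ?r) * ennreal (norm (G y) powr ?r) \<partial>lborel \<partial>lborel)"
    by (simp add: lborel_prod[symmetric] lborel.nn_integral_fst[symmetric] powr_mult ennreal_mult case_prod_beta)
  also have "\<dots> = (\<integral>\<^sup>+ x. ennreal (norm (F x) powr ?r) \<partial>lborel) * (\<integral>\<^sup>+ y. ennreal (norm (G y) powr ?r) \<partial>lborel)"
    by (simp add: nn_integral_cmult nn_integral_multc)
  finally show ?thesis using False r
    by (simp add: L_norm_finite root_ennreal_mult[symmetric])
qed

text \<open>The spectrogram is a square, so this turns norms of the STFT with exponent
  \<open>2 * p\<close> into norms of the spectrogram with exponent \<open>p\<close>. For
  \<open>p = \<infinity>\<close>, where \<open>2 * p = \<infinity>\<close>, it moves a square out of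
  an essential supremum.\<close>

lemma L_norm_double_exponent:
  fixes F :: "'a::euclidean_space \<Rightarrow> 'b::real_normed_vector"
  assumes p: "1 \<le> p" and [measurable]: "(\<lambda>x. norm (F x)) \<in> borel_measurable borel"
  shows "(L_norm (2 * p) F)\<^sup>2 \<le> L_norm p (\<lambda>x. (norm (F x))\<^sup>2)"
proof (cases "p = \<infinity>")
  case True
  define c where "c = L_norm top (\<lambda>x. (norm (F x))\<^sup>2)"
  have c: "AE x in lborel. ennreal ((norm (F x))\<^sup>2) \<le> c"
    using esssup_AE[of "\<lambda>x. ennreal (norm ((norm (F x))\<^sup>2))" lborel] by (simp add: c_def L_norm_top)
  have "(L_norm top F)\<^sup>2 \<le> c"
  proof (cases c)
    case (real k)
    have "AE x in lborel. ennreal (norm (F x)) \<le> ennreal (sqrt k)"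
      using c by eventually_elim (use real in \<open>auto intro!: ennreal_leI real_le_rsqrt\<close>)
    then have "L_norm top F \<le> ennreal (sqrt k)" unfolding L_norm_top by (intro esssup_I) auto
    then have "(L_norm top F)\<^sup>2 \<le> (ennreal (sqrt k))\<^sup>2" by (rule power_mono) auto
    then show ?thesis using real by (simp add: ennreal_power)
  qed simp
  then show ?thesis using True by (simp add: c_def ennreal_mult_top)
next
  case False
  note r = exponent_real[OF p False]
  define r where "r = enn2real p"
  have r1: "r \<ge> 1" "p = ennreal r" using r by (auto simp: r_def)
  have p2: "2 * p = ennreal (2 * r)" using r1 by (simp add: ennreal_mult)
  let ?I = "\<integral>\<^sup>+ x. ennreal (norm (F x) powr (2 * r)) \<partial>lborel"
  have "norm ((norm (F x))\<^sup>2) powr r = norm (F x) powr (2 * r)" for x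
    by (simp add: powr_powr[symmetric] powr_numeral)
  then have "L_norm p (\<lambda>x. (norm (F x))\<^sup>2) = root_ennreal r ?I"
    using r1 by (simp add: L_norm_finite)
  moreover have "L_norm (2 * p) F = root_ennreal (2 * r) ?I"
    using r1 unfolding p2 by (subst L_norm_finite) auto
  moreover have "(root_ennreal (2 * r) J)\<^sup>2 = root_ennreal r J" for J
    using r1 by (cases J) (auto simp: root_ennreal_def ennreal_mult[symmetric] power2_eq_square powr_add[symmetric])
  ultimately show ?thesis by simp
qed


section \<open>Fourier transforms and convolutions\<close>

lemma cis_measurable [measurable]: "cis \<in> borel_measurable borel"
  by (intro borel_measurable_continuous_onI continuous_intros)

lemma cnj_measurable [measurable]: "cnj \<in> borel_measurable borel"
  by (intro borel_measurable_continuous_onI continuous_intros)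

section \<open>Coordinatewise products and the Gaussian density\<close>

lemma
  fixes f :: "'a::euclidean_space \<Rightarrow> real \<Rightarrow> complex"
  assumes f: "\<And>b. b \<in> Basis \<Longrightarrow> integrable lborel (f b)"
  shows integrable_lborel_prod: "integrable lborel (\<lambda>x. \<Prod>b\<in>Basis. f b (x \<bullet> b))"
    and integral_lborel_prod:
      "(LINT x|lborel. (\<Prod>b\<in>Basis. f b (x \<bullet> b))) = (\<Prod>b\<in>Basis. (LINT x|lborel. f b x))"
proof -
  interpret product_sigma_finite "\<lambda>_::'a. lborel :: real measure"
    by standard
  have [measurable]: "f b \<in> borel_measurable borel" if "b \<in> Basis" for b
    using borel_measurable_integrable[OF f[OF that]] by simp
  show "integrable lborel (\<lambda>x. \<Prod>b\<in>Basis. f b (x \<bullet> b))"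
    unfolding lborel_eq[where 'a='a]
    by (subst integrable_distr_eq) (auto intro!: product_integrable_prod f)
  show "(LINT x|lborel. (\<Prod>b\<in>Basis. f b (x \<bullet> b))) = (\<Prod>b\<in>Basis. (LINT x|lborel. f b x))"
    unfolding lborel_eq[where 'a='a]
    by (subst integral_distr) (auto intro!: product_integral_prod f)
qed

lemma integrable_tensor:
  fixes F :: "'a::euclidean_space \<Rightarrow> complex" and G :: "'b::euclidean_space \<Rightarrow> complex"
  assumes F: "integrable lborel F" and G: "integrable lborel G"
  shows "integrable (lborel \<Otimes>\<^sub>M lborel) (\<lambda>(x, y). F x * G y)"
proof (rule integrableI_bounded)
  have [measurable]: "F \<in> borel_measurable borel" "G \<in> borel_measurable borel"
    using F G by auto
  show "(\<lambda>(x, y). F x * G y) \<in> borel_measurable (lborel \<Otimes>\<^sub>M lborel)" by measurable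
  have "(\<integral>\<^sup>+ z. ennreal (norm (case z of (x, y) \<Rightarrow> F x * G y)) \<partial>(lborel \<Otimes>\<^sub>M lborel))
    = (\<integral>\<^sup>+ x. ennreal (norm (F x)) \<partial>lborel) * (\<integral>\<^sup>+ y. ennreal (norm (G y)) \<partial>lborel)"
    by (simp add: lborel.nn_integral_fst[symmetric] norm_mult ennreal_mult nn_integral_cmult nn_integral_multc)
  also have "\<dots> < \<infinity>"
    using F G by (simp add: integrable_iff_bounded ennreal_mult_less_top)
  finally show "(\<integral>\<^sup>+ z. ennreal (norm (case z of (x, y) \<Rightarrow> F x * G y)) \<partial>(lborel \<Otimes>\<^sub>M lborel)) < \<infinity>" .
qed

text \<open>Normalised as a probability density, so that its dilates form an approximate identity.
  The constant is also the maximum of the density, and its square times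
  \<open>(2 * pi) ^ DIM('a)\<close> is 1, which gives the constant in the inversion bound.\<close>

definition gauss :: "'a::euclidean_space \<Rightarrow> real" where
  "gauss x = (2 * pi) powr (- DIM('a) / 2) * exp (- (norm x)\<^sup>2 / 2)"

lemma gauss_measurable [measurable]: "gauss \<in> borel_measurable borel"
  unfolding gauss_def by measurable

lemma gauss_nonneg [simp]: "0 \<le> gauss x"
  by (simp add: gauss_def)

lemma gauss_le: "gauss (x :: 'a::euclidean_space) \<le> (2 * pi) powr (- DIM('a) / 2)"
  by (simp add: gauss_def mult_le_cancel_left1)

lemma gauss_eq_prod: "gauss x = (\<Prod>b\<in>Basis. std_normal_density (x \<bullet> b))"
proof -
  have "(\<Prod>b\<in>Basis. std_normal_density (x \<bullet> b))
      = (1 / sqrt (2 * pi)) ^ DIM('a) * exp (\<Sum>b\<in>Basis. - (x \<bullet> b)\<^sup>2 / 2)"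
    by (simp add: std_normal_density_def exp_sum prod_dividef power_one_over)
  also have "(\<Sum>b\<in>Basis. - (x \<bullet> b)\<^sup>2 / 2) = - (norm x)\<^sup>2 / 2"
    unfolding power2_norm_eq_inner euclidean_inner[of x x]
    by (simp add: power2_eq_square sum_negf sum_divide_distrib)
  also have "(1 / sqrt (2 * pi)) ^ DIM('a) = (2 * pi) powr (- DIM('a) / 2)"
    by (simp add: powr_realpow[symmetric] powr_half_sqrt[symmetric] powr_powr powr_minus_divide[symmetric])
  finally show ?thesis by (simp add: gauss_def)
qed

lemma integrable_gauss: "integrable lborel (\<lambda>x. complex_of_real (gauss x))"
  unfolding gauss_eq_prod of_real_prod
  by (rule integrable_lborel_prod) (intro integrable_of_real integrable_normal_density; simp)

text \<open>The integrand factors over the coordinates, and each factor integrates to the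
  characteristic function of the one-dimensional standard normal distribution.\<close>

lemma char_gauss:
  "(LINT x|lborel. cis (x \<bullet> t) * complex_of_real (gauss x)) = complex_of_real (exp (- (norm t)\<^sup>2 / 2))"
proof -
  have eq: "cis (x \<bullet> t) * complex_of_real (gauss x)
      = (\<Prod>b\<in>Basis. cis ((t \<bullet> b) * (x \<bullet> b)) * complex_of_real (std_normal_density (x \<bullet> b)))" for x
  proof -
    have "cis (x \<bullet> t) = (\<Prod>b\<in>Basis. cis ((t \<bullet> b) * (x \<bullet> b)))"
      by (simp add: cis_conv_exp euclidean_inner[of x t] sum_distrib_left exp_sum mult.commute)
    then show ?thesis by (simp add: prod.distrib gauss_eq_prod)
  qed
  have int: "integrable lborel (\<lambda>y. cis (s * y) * complex_of_real (std_normal_density y))" for s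
    by (rule Bochner_Integration.integrable_bound[of _ std_normal_density])
       (auto simp: norm_mult intro!: integrable_normal_density)
  have "(LINT y|lborel. cis (s * y) * complex_of_real (std_normal_density y))
      = char std_normal_distribution s" for s
    unfolding char_def
    by (subst integral_density) (auto simp: cis_conv_exp scaleR_conv_of_real mult.commute)
  then have val: "(LINT y|lborel. cis (s * y) * complex_of_real (std_normal_density y))
      = complex_of_real (exp (- s\<^sup>2 / 2))" for s
    by (simp add: char_std_normal_distribution)
  have "(LINT x|lborel. cis (x \<bullet> t) * complex_of_real (gauss x))
      = (\<Prod>b\<in>Basis. complex_of_real (exp (- (t \<bullet> b)\<^sup>2 / 2)))"
    unfolding eq by (subst integral_lborel_prod) (simp_all add: int val)
  also have "\<dots> = complex_of_real (exp (\<Sum>b\<in>Basis. - (t \<bullet> b)\<^sup>2 / 2))"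
    by (simp only: exp_sum[OF finite_Basis] of_real_prod)
  also have "(\<Sum>b\<in>Basis. - (t \<bullet> b)\<^sup>2 / 2) = - (norm t)\<^sup>2 / 2"
    unfolding power2_norm_eq_inner euclidean_inner[of t t]
    by (simp add: power2_eq_square sum_negf sum_divide_distrib)
  finally show ?thesis .
qed

lemma integral_gauss: "integral\<^sup>L lborel (gauss :: 'a::euclidean_space \<Rightarrow> real) = 1"
  using char_gauss[of "0 :: 'a"] by simp

lemma fourier_measurable [measurable]:
  assumes [measurable]: "f \<in> borel_measurable borel"
  shows "fourier f \<in> borel_measurable borel"
proof -
  have [measurable]: "f \<in> borel_measurable lborel" by simp
  show ?thesis unfolding fourier_def[abs_def] by measurable
qed

text \<open>Up to constants the Gaussian is its own Fourier transform. Inserting this and exchanging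
  the integrals expresses the Gaussian mean of \<open>h\<close> around \<open>y\<close> through the
  Fourier transform of \<open>h\<close>. The bound is uniform in the width \<open>e\<close>.\<close>

lemma gauss_average_bound:
  fixes h :: "'a::euclidean_space \<Rightarrow> complex"
  assumes h: "integrable lborel h" and e: "e > 0"
  shows "ennreal (cmod (LINT t|lborel. h (y + e *\<^sub>R t) * complex_of_real (gauss t)))
    * ennreal ((2 * pi) ^ DIM('a)) \<le> (\<integral>\<^sup>+ \<xi>. ennreal (cmod (fourier h \<xi>)) \<partial>lborel)"
proof -
  define c where "c = (2 * pi) powr (- DIM('a) / 2)"
  have c: "c > 0" by (simp add: c_def)
  have "c * c * (2 * pi) ^ DIM('a) = (2 * pi) powr (- DIM('a) / 2 + - DIM('a) / 2 + DIM('a))"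
    unfolding c_def powr_add by (simp add: powr_realpow)
  then have c2: "c * c * (2 * pi) ^ DIM('a) = 1" by simp
  have [measurable]: "h \<in> borel_measurable borel" using h by auto
  define H where "H = (\<lambda>t. h (y + e *\<^sub>R t))"
  have H: "integrable lborel H" unfolding H_def using integrable_lborel_affine[OF h] e by simp
  then have [measurable]: "H \<in> borel_measurable borel" by auto
  \<comment> \<open>Substitution \<open>u = y + e *\<^sub>R t\<close>. The sign in
    \<open>- (1 / e)\<close> appears because the Gaussian is expanded with
    \<open>cis (x \<bullet> t)\<close>, whereas \<open>fourier\<close> uses the opposite
    sign.\<close>
  have FH: "(LINT t|lborel. H t * cis (x \<bullet> t))
      = (1 / e ^ DIM('a)) *\<^sub>R (cis (- (x \<bullet> y) / e) * fourier h (0 + (- (1 / e)) *\<^sub>R x))" for x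
  proof -
    have "cis (- (x \<bullet> y) / e) * fourier h (0 + (- (1 / e)) *\<^sub>R x)
       = (LINT u|lborel. h u * cis (x \<bullet> (u - y) / e))"
      unfolding fourier_def
      by (subst integral_mult_right_zero[symmetric], intro Bochner_Integration.integral_cong refl)
         (simp add: cis_mult inner_commute inner_diff_right diff_divide_distrib mult_ac)
    also have "\<dots> = e ^ DIM('a) *\<^sub>R (LINT t|lborel. H t * cis (x \<bullet> t))"
      using e by (subst integral_lborel_affine[where c=e and t=y]) (auto simp: H_def)
    finally show ?thesis using e by simp
  qed
  have "(LINT t|lborel. H t * complex_of_real (gauss t))
     = c *\<^sub>R (LINT t|lborel. LINT x|lborel. H t * (cis (x \<bullet> t) * complex_of_real (gauss x)))"
  proof -
    have "(LINT x|lborel. H t * (cis (x \<bullet> t) * complex_of_real (gauss x)))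
        = H t * complex_of_real (exp (- (norm t)\<^sup>2 / 2))" for t
      by (simp only: integral_mult_right_zero char_gauss)
    moreover have "H t * complex_of_real (gauss t)
        = complex_of_real c * (H t * complex_of_real (exp (- (norm t)\<^sup>2 / 2)))" for t
      by (simp add: gauss_def c_def)
    ultimately show ?thesis by (simp only: integral_mult_right_zero scaleR_conv_of_real)
  qed
  also have "(LINT t|lborel. LINT x|lborel. H t * (cis (x \<bullet> t) * complex_of_real (gauss x)))
     = (LINT x|lborel. LINT t|lborel. H t * (cis (x \<bullet> t) * complex_of_real (gauss x)))"
  proof (rule lborel_pair.Fubini_integral)
    have "integrable (lborel \<Otimes>\<^sub>M lborel) (\<lambda>(x, t). complex_of_real (gauss (x::'a)) * H t)"
      by (intro integrable_tensor integrable_gauss H)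
    then show "integrable (lborel \<Otimes>\<^sub>M lborel) (\<lambda>(x, t). H t * (cis (x \<bullet> t) * complex_of_real (gauss x)))"
      by (rule Bochner_Integration.integrable_bound) (auto simp: norm_mult case_prod_beta)
  qed
  also have "\<dots> = (LINT x|lborel. complex_of_real (gauss x) * (LINT t|lborel. H t * cis (x \<bullet> t)))"
    by (simp add: mult_ac flip: Bochner_Integration.integral_mult_right_zero)
  finally have eq: "(LINT t|lborel. H t * complex_of_real (gauss t))
     = c *\<^sub>R (LINT x|lborel. complex_of_real (gauss x) * (LINT t|lborel. H t * cis (x \<bullet> t)))" .
  have "ennreal (cmod (LINT t|lborel. H t * complex_of_real (gauss t)))
     \<le> ennreal c * (\<integral>\<^sup>+ x. ennreal (cmod (complex_of_real (gauss x) * (LINT t|lborel. H t * cis (x \<bullet> t)))) \<partial>lborel)"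
    unfolding eq using c
    by (auto simp: ennreal_mult intro!: mult_left_mono norm_integral_le_nn_integral)
  \<comment> \<open>The remaining Gaussian is bounded by its maximum \<open>c\<close>; the dilation
    then produces \<open>e ^ DIM('a)\<close>, which cancels the factor from
    \<open>FH\<close>.\<close>
  also have "\<dots> \<le> ennreal c * (\<integral>\<^sup>+ x. ennreal (c / e ^ DIM('a)) * ennreal (cmod (fourier h (0 + (- (1 / e)) *\<^sub>R x))) \<partial>lborel)"
  proof (intro mult_left_mono nn_integral_mono)
    fix x :: 'a
    have "gauss x * (1 / e ^ DIM('a) * cmod (fourier h (0 + (- (1 / e)) *\<^sub>R x)))
       \<le> c * (1 / e ^ DIM('a) * cmod (fourier h (0 + (- (1 / e)) *\<^sub>R x)))"
      using e gauss_le[of x] unfolding c_def by (intro mult_right_mono) auto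
    then show "ennreal (cmod (complex_of_real (gauss x) * (LINT t|lborel. H t * cis (x \<bullet> t))))
       \<le> ennreal (c / e ^ DIM('a)) * ennreal (cmod (fourier h (0 + (- (1 / e)) *\<^sub>R x)))"
      using e c unfolding FH by (simp add: norm_mult ennreal_mult[symmetric])
  qed auto
  also have "\<dots> = ennreal c * (ennreal (c / e ^ DIM('a)) *
       (\<integral>\<^sup>+ x. ennreal (cmod (fourier h (0 + (- (1 / e)) *\<^sub>R x))) \<partial>lborel))"
    by (subst nn_integral_cmult) auto
  also have "(\<integral>\<^sup>+ x. ennreal (cmod (fourier h (0 + (- (1 / e)) *\<^sub>R x))) \<partial>lborel)
     = ennreal (e ^ DIM('a)) * (\<integral>\<^sup>+ \<xi>. ennreal (cmod (fourier h \<xi>)) \<partial>lborel)"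
    using e nn_integral_lborel_affine[of "\<lambda>\<xi>. ennreal (cmod (fourier h \<xi>))" "- (1 / e)" 0]
    by (simp add: power_one_over mult.assoc[symmetric] ennreal_mult[symmetric])
  also have "ennreal c * (ennreal (c / e ^ DIM('a)) * (ennreal (e ^ DIM('a)) * (\<integral>\<^sup>+ \<xi>. ennreal (cmod (fourier h \<xi>)) \<partial>lborel)))
      = ennreal (c * c) * (\<integral>\<^sup>+ \<xi>. ennreal (cmod (fourier h \<xi>)) \<partial>lborel)"
    using c e by (simp add: mult.assoc[symmetric] ennreal_mult[symmetric])
  finally have "ennreal (cmod (LINT t|lborel. H t * complex_of_real (gauss t))) * ennreal ((2 * pi) ^ DIM('a))
    \<le> (ennreal (c * c) * (\<integral>\<^sup>+ \<xi>. ennreal (cmod (fourier h \<xi>)) \<partial>lborel)) * ennreal ((2 * pi) ^ DIM('a))"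
    by (rule mult_right_mono) auto
  also have "\<dots> = ennreal (c * c * (2 * pi) ^ DIM('a)) * (\<integral>\<^sup>+ \<xi>. ennreal (cmod (fourier h \<xi>)) \<partial>lborel)"
    using c by (subst ennreal_mult) (auto simp: mult_ac)
  finally show ?thesis unfolding H_def c2 by simp
qed

text \<open>Substitute for Fourier inversion: the Gaussian means tend to \<open>h y\<close> by
  continuity and dominated convergence, with \<open>B * gauss t\<close> as majorant, while their
  bound is independent of the width. The right side may be \<infinity>.\<close>

lemma norm_le_fourier_L1:
  fixes h :: "'a::euclidean_space \<Rightarrow> complex"
  assumes h: "integrable lborel h" and B: "\<And>x. cmod (h x) \<le> B" and cont: "continuous_on UNIV h"
  shows "ennreal (cmod (h y)) * ennreal ((2 * pi) ^ DIM('a))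
    \<le> (\<integral>\<^sup>+ \<xi>. ennreal (cmod (fourier h \<xi>)) \<partial>lborel)"
proof -
  have [measurable]: "h \<in> borel_measurable borel" using h by auto
  define e where "e n = 1 / real (Suc n)" for n
  have e0: "e \<longlonglongrightarrow> 0" unfolding e_def by (rule LIMSEQ_Suc[OF lim_1_over_n])
  have "(\<lambda>n. LINT t|lborel. h (y + e n *\<^sub>R t) * complex_of_real (gauss t))
      \<longlonglongrightarrow> (LINT t|lborel. h y * complex_of_real (gauss (t::'a)))"
  proof (rule integral_dominated_convergence[where w="\<lambda>t::'a. B * gauss t"])
    show "integrable lborel (\<lambda>t::'a. B * gauss t)"
      using integrable_norm[OF integrable_gauss[where 'a='a]] by simp
    show "AE t in lborel. (\<lambda>n. h (y + e n *\<^sub>R t) * complex_of_real (gauss t))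
        \<longlonglongrightarrow> h y * complex_of_real (gauss t)"
    proof (intro AE_I2 tendsto_mult tendsto_const)
      fix t :: 'a
      have "(\<lambda>n. y + e n *\<^sub>R t) \<longlonglongrightarrow> y + 0 *\<^sub>R t" by (intro tendsto_intros e0)
      then show "(\<lambda>n. h (y + e n *\<^sub>R t)) \<longlonglongrightarrow> h y"
        using cont by (auto simp: continuous_on_eq_continuous_at intro: isCont_tendsto_compose)
    qed
  qed (auto simp: norm_mult intro!: mult_right_mono B)
  then have "(\<lambda>n. LINT t|lborel. h (y + e n *\<^sub>R t) * complex_of_real (gauss t)) \<longlonglongrightarrow> h y"
    by (simp add: integral_gauss)
  then have "(\<lambda>n. ennreal (cmod (LINT t|lborel. h (y + e n *\<^sub>R t) * complex_of_real (gauss t))) * ennreal ((2 * pi) ^ DIM('a)))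
     \<longlonglongrightarrow> ennreal (cmod (h y)) * ennreal ((2 * pi) ^ DIM('a))"
    unfolding ennreal_mult[symmetric, OF norm_ge_zero zero_le_power[OF mult_nonneg_nonneg[OF zero_le_numeral pi_ge_zero]]]
    by (intro tendsto_ennrealI tendsto_mult tendsto_norm tendsto_const)
  then show ?thesis
    by (rule LIMSEQ_le_const2) (intro exI allI impI gauss_average_bound h; simp add: e_def)
qed

section \<open>Convolutions of functions\<close>

lemma cis_minus_inner_add_right: "cis (- (x \<bullet> (a + b))) = cis (- (x \<bullet> a)) * cis (- (x \<bullet> b))"
  by (simp add: cis_mult inner_add_right)

lemma cis_minus_inner_add_left: "cis (- ((a + b) \<bullet> x)) = cis (- (a \<bullet> x)) * cis (- (b \<bullet> x))"
  by (simp add: cis_mult inner_add_left)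

text \<open>A convolution of two functions, as opposed to \<open>convolution\<close>, whose first
  argument is a functional.\<close>

definition convol :: "('a::euclidean_space \<Rightarrow> complex) \<Rightarrow> ('a \<Rightarrow> complex) \<Rightarrow> 'a \<Rightarrow> complex" where
  "convol F G y = (LINT u|lborel. F u * G (y - u))"

lemma convol_commute:
  assumes [measurable]: "F \<in> borel_measurable borel" "G \<in> borel_measurable borel"
  shows "convol F G y = (LINT v|lborel. F (y - v) * G v)"
  unfolding convol_def
  using integral_lborel_reflect[of "\<lambda>u. F u * G (y - u)" y] by simp

lemma integrable_convol_pair:
  fixes F G :: "'a::euclidean_space \<Rightarrow> complex"
  assumes F: "integrable lborel F" and G: "integrable lborel G"
  shows "integrable (lborel \<Otimes>\<^sub>M lborel) (\<lambda>(y, u). F u * G (y - u :: 'a::euclidean_space))"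
proof (rule integrableI_bounded)
  have [measurable]: "F \<in> borel_measurable borel" "G \<in> borel_measurable borel"
    "F \<in> borel_measurable lborel" using F G by auto
  show m: "(\<lambda>(y, u). F u * G (y - u :: 'a)) \<in> borel_measurable (lborel \<Otimes>\<^sub>M lborel)"
    by measurable
  have "(\<integral>\<^sup>+ z. ennreal (norm (case z of (y, u) \<Rightarrow> F u * G (y - u))) \<partial>(lborel \<Otimes>\<^sub>M lborel))
    = (\<integral>\<^sup>+ u. (\<integral>\<^sup>+ y. ennreal (norm (F u * G (y - u))) \<partial>lborel) \<partial>lborel)"
    by (subst lborel_pair.nn_integral_snd[symmetric]) auto
  also have "\<dots> = (\<integral>\<^sup>+ u. ennreal (norm (F u)) * (\<integral>\<^sup>+ y. ennreal (norm (G y)) \<partial>lborel) \<partial>lborel)"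
  proof (intro nn_integral_cong)
    fix u :: 'a
    have "(\<integral>\<^sup>+ y. ennreal (norm (G (y - u))) \<partial>lborel) = (\<integral>\<^sup>+ y. ennreal (norm (G y)) \<partial>lborel)"
      using nn_integral_lborel_affine[of "\<lambda>y. ennreal (norm (G y))" 1 "- u"] by simp
    then show "(\<integral>\<^sup>+ y. ennreal (norm (F u * G (y - u))) \<partial>lborel)
        = ennreal (norm (F u)) * (\<integral>\<^sup>+ y. ennreal (norm (G y)) \<partial>lborel)"
      by (simp add: norm_mult ennreal_mult nn_integral_cmult)
  qed
  also have "\<dots> < \<infinity>"
    using F G by (simp add: integrable_iff_bounded ennreal_mult_less_top nn_integral_multc)
  finally show "(\<integral>\<^sup>+ z. ennreal (norm (case z of (y, u) \<Rightarrow> F u * G (y - u))) \<partial>(lborel \<Otimes>\<^sub>M lborel)) < \<infinity>" .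
qed

lemma integrable_convol:
  assumes "integrable lborel F" "integrable lborel G"
  shows "integrable lborel (convol F G)"
  using lborel_pair.integrable_fst'[OF integrable_convol_pair[OF assms]]
  by (simp add: convol_def[abs_def])

lemma fourier_convol:
  assumes F: "integrable lborel F" and G: "integrable lborel G"
  shows "fourier (convol F G) \<zeta> = fourier F \<zeta> * fourier G \<zeta>"
proof -
  have [measurable]: "F \<in> borel_measurable borel" "G \<in> borel_measurable borel"
    "F \<in> borel_measurable lborel" using F G by auto
  have "integrable (lborel \<Otimes>\<^sub>M lborel) (\<lambda>(y, u). cis (- (y \<bullet> \<zeta>)) * (F u * G (y - u)))"
    by (rule Bochner_Integration.integrable_bound[OF integrable_convol_pair[OF F G]])
       (auto simp: norm_mult case_prod_beta)
  then have "(LINT y|lborel. (LINT u|lborel. cis (- (y \<bullet> \<zeta>)) * (F u * G (y - u))))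
    = (LINT u|lborel. (LINT y|lborel. cis (- (y \<bullet> \<zeta>)) * (F u * G (y - u))))"
    by (rule lborel_pair.Fubini_integral[symmetric])
  also have "\<dots> = (LINT u|lborel. (cis (- (u \<bullet> \<zeta>)) * F u) * fourier G \<zeta>)"
  proof (intro Bochner_Integration.integral_cong refl)
    fix u :: 'a
    have "(LINT y|lborel. cis (- (y \<bullet> \<zeta>)) * (F u * G (y - u)))
       = (LINT y|lborel. cis (- ((u + 1 *\<^sub>R y) \<bullet> \<zeta>)) * (F u * G ((u + 1 *\<^sub>R y) - u)))"
      by (subst integral_lborel_affine[where c=1 and t=u]) auto
    also have "\<dots> = (LINT y|lborel. (cis (- (u \<bullet> \<zeta>)) * F u) * (cis (- (y \<bullet> \<zeta>)) * G y))"
      by (intro Bochner_Integration.integral_cong refl)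
         (simp add: cis_minus_inner_add_left mult_ac)
    finally show "(LINT y|lborel. cis (- (y \<bullet> \<zeta>)) * (F u * G (y - u)))
        = (cis (- (u \<bullet> \<zeta>)) * F u) * fourier G \<zeta>"
      by (simp only: integral_mult_right_zero fourier_def)
  qed
  also have "\<dots> = fourier F \<zeta> * fourier G \<zeta>"
    by (simp only: integral_mult_left_zero fourier_def[of F])
  finally show ?thesis
    by (simp only: integral_mult_right_zero fourier_def[of "convol F G"] convol_def)
qed

lemma norm_convol_le:
  fixes F :: "'a::euclidean_space \<Rightarrow> complex"
  assumes F: "F \<in> borel_measurable borel" "\<And>x. cmod (F x) \<le> B" and G: "integrable lborel G"
  shows "cmod (convol F G y) \<le> B * (LINT v|lborel. cmod (G v))"
proof -
  have B: "B \<ge> 0" using F(2)[of 0] norm_ge_zero[of "F 0"] by linarith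
  have [measurable]: "F \<in> borel_measurable borel" "G \<in> borel_measurable borel" using F G by auto
  have int: "integrable lborel (\<lambda>v. B * cmod (G v))" using G by auto
  have "cmod (LINT v|lborel. F (y - v) * G v) \<le> (LINT v|lborel. B * cmod (G v))"
    by (rule Bochner_Integration.integral_norm_bound_integral[OF Bochner_Integration.integrable_bound[OF int] int])
       (use B F(2) in \<open>auto simp: norm_mult intro!: mult_right_mono\<close>)
  then show ?thesis by (simp add: convol_commute)
qed

lemma continuous_convol:
  fixes F :: "'a::euclidean_space \<Rightarrow> complex"
  assumes F: "continuous_on UNIV F" "\<And>x. cmod (F x) \<le> B" and G: "integrable lborel G"
  shows "continuous_on UNIV (convol F G)"
proof -
  have [measurable]: "F \<in> borel_measurable borel" "G \<in> borel_measurable borel"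
    using F(1) G by (auto intro: borel_measurable_continuous_onI)
  have "(\<lambda>n. convol F G (s n)) \<longlonglongrightarrow> convol F G y" if s: "s \<longlonglongrightarrow> y" for s y
    unfolding convol_commute[OF \<open>F \<in> _\<close> \<open>G \<in> _\<close>]
  proof (rule integral_dominated_convergence[where w="\<lambda>v. B * cmod (G v)"])
    show "integrable lborel (\<lambda>v. B * cmod (G v))" using G by auto
    show "AE v in lborel. (\<lambda>n. F (s n - v) * G v) \<longlonglongrightarrow> F (y - v) * G v"
    proof (intro AE_I2 tendsto_mult tendsto_const)
      fix v
      have "(\<lambda>n. s n - v) \<longlonglongrightarrow> y - v" by (intro tendsto_intros s)
      then show "(\<lambda>n. F (s n - v)) \<longlonglongrightarrow> F (y - v)"
        using F(1) by (auto simp: continuous_on_eq_continuous_at intro: isCont_tendsto_compose)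
    qed
  qed (auto simp: norm_mult intro!: mult_right_mono F(2))
  then show ?thesis
    by (simp add: continuous_on_sequentially o_def)
qed

text \<open>\<open>norm_le_fourier_L1\<close> for a convolution: a bounded continuous factor makes
  it bounded and continuous, integrable factors make it integrable, and its Fourier transform is a
  product.\<close>

lemma norm_convol_le_fourier:
  fixes F :: "'a::euclidean_space \<Rightarrow> complex"
  assumes F: "integrable lborel F" "continuous_on UNIV F" "\<And>x. cmod (F x) \<le> B"
    and G: "integrable lborel G"
  shows "ennreal (cmod (convol F G y)) * ennreal ((2 * pi) ^ DIM('a))
    \<le> (\<integral>\<^sup>+ \<zeta>. ennreal (cmod (fourier F \<zeta>) * cmod (fourier G \<zeta>)) \<partial>lborel)"
  using norm_le_fourier_L1[OF integrable_convol[OF F(1) G] norm_convol_le continuous_convol[OF F(2,3) G], of B y] F G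
  by (simp add: fourier_convol norm_mult)

lemma fourier_modulate: "fourier (\<lambda>x. f x * cis (- (x \<bullet> a))) \<zeta> = fourier f (\<zeta> + a)"
  by (simp add: fourier_def cis_minus_inner_add_right mult_ac)

lemma fourier_cnj: "fourier (\<lambda>x. cnj (f x)) \<zeta> = cnj (fourier f (- \<zeta>))"
proof -
  have "fourier (\<lambda>x. cnj (f x)) \<zeta> = (LINT x|lborel. cnj (cis (x \<bullet> \<zeta>) * f x))"
    by (simp add: fourier_def cis_cnj)
  also have "\<dots> = cnj (fourier f (- \<zeta>))"
    by (simp add: fourier_def del: complex_cnj_mult)
  finally show ?thesis .
qed

lemma fourier_involution:
  assumes [measurable]: "f \<in> borel_measurable borel"
  shows "fourier (\<lambda>x. cnj (f (- x))) \<zeta> = cnj (fourier f \<zeta>)"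
proof -
  have "fourier (\<lambda>x. cnj (f (- x))) \<zeta> = (LINT x|lborel. cnj (cis (- (x \<bullet> \<zeta>)) * f x))"
    using integral_lborel_reflect[of "\<lambda>x. cis (x \<bullet> \<zeta>) * cnj (f x)" 0]
    by (simp add: fourier_def cis_cnj)
  also have "\<dots> = cnj (fourier f \<zeta>)"
    by (simp add: fourier_def del: complex_cnj_mult)
  finally show ?thesis .
qed


section \<open>Pointwise bounds of time-frequency representations\<close>

lemma borel_measurable_fst_snd [measurable]:
  "(fst :: 'a::euclidean_space \<times> 'b::euclidean_space \<Rightarrow> 'a) \<in> borel_measurable borel"
  "(snd :: 'a::euclidean_space \<times> 'b::euclidean_space \<Rightarrow> 'b) \<in> borel_measurable borel"
  by (intro borel_measurable_continuous_onI continuous_intros)+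

lemma Wig_measurable [measurable]:
  fixes f :: "'a::euclidean_space \<Rightarrow> complex"
  assumes [measurable]: "f \<in> borel_measurable borel"
  shows "Wig f \<in> borel_measurable borel"
  unfolding Wig_def borel_prod[symmetric] by measurable

lemma STFT_measurable [measurable]:
  fixes f :: "'a::euclidean_space \<Rightarrow> complex"
  assumes [measurable]: "f \<in> borel_measurable borel" "g \<in> borel_measurable borel"
  shows "STFT g f \<in> borel_measurable borel"
proof -
  have [measurable]: "f \<in> borel_measurable lborel" by simp
  show ?thesis unfolding STFT_def borel_prod[symmetric] by measurable
qed

lemma Rihaczek_measurable [measurable]:
  fixes f :: "'a::euclidean_space \<Rightarrow> complex"
  assumes [measurable]: "f \<in> borel_measurable borel"
  shows "Rihaczek f \<in> borel_measurable borel"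
  unfolding Rihaczek_def borel_prod[symmetric] by measurable

text \<open>Substitute \<open>u = x + (1/2) *\<^sub>R t\<close>: then
  \<open>x - (1/2) *\<^sub>R t\<close> becomes \<open>2 *\<^sub>R x - u\<close>, and the phase in
  \<open>t\<close> becomes a modulation in \<open>u\<close> times a phase independent of
  \<open>u\<close>. The Jacobian gives \<open>2 ^ DIM('a)\<close>.\<close>

lemma Wig_eq_convol:
  fixes f :: "'a::euclidean_space \<Rightarrow> complex"
  assumes [measurable]: "f \<in> borel_measurable borel"
  shows "cmod (Wig f (x, \<xi>)) = 2 ^ DIM('a) *
    cmod (convol (\<lambda>u. f u * cis (- (u \<bullet> (2 *\<^sub>R \<xi>)))) (\<lambda>v. cnj (f v)) (2 *\<^sub>R x))"
proof -
  have [measurable]: "f \<in> borel_measurable lborel" by simp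
  have arg: "2 *\<^sub>R x - (x + (1/2) *\<^sub>R t) = x - (1/2) *\<^sub>R t" for t
    by (simp add: scaleR_2)
  have "convol (\<lambda>u. f u * cis (- (u \<bullet> (2 *\<^sub>R \<xi>)))) (\<lambda>v. cnj (f v)) (2 *\<^sub>R x)
      = (1/2) ^ DIM('a) *\<^sub>R (LINT t|lborel. f (x + (1/2) *\<^sub>R t) *
          cis (- ((x + (1/2) *\<^sub>R t) \<bullet> (2 *\<^sub>R \<xi>))) * cnj (f (x - (1/2) *\<^sub>R t)))"
    unfolding convol_def by (subst integral_lborel_affine[where c="1/2" and t=x]) (auto simp: arg)
  also have "(LINT t|lborel. f (x + (1/2) *\<^sub>R t) *
          cis (- ((x + (1/2) *\<^sub>R t) \<bullet> (2 *\<^sub>R \<xi>))) * cnj (f (x - (1/2) *\<^sub>R t)))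
      = cis (- (x \<bullet> (2 *\<^sub>R \<xi>))) * Wig f (x, \<xi>)"
    unfolding Wig_def cis_minus_inner_add_left prod.case
    by (subst integral_mult_right_zero[symmetric], intro Bochner_Integration.integral_cong refl)
       (simp add: mult_ac)
  finally show ?thesis by (simp add: norm_mult power_one_over)
qed

lemma Wig_le:
  fixes f :: "'a::euclidean_space \<Rightarrow> complex"
  assumes [measurable]: "f \<in> borel_measurable borel"
  shows "ennreal (cmod (Wig f (x, \<xi>)))
    \<le> ennreal (2 ^ DIM('a)) * (\<integral>\<^sup>+ u. ennreal (cmod (f u) * cmod (f (2 *\<^sub>R x - u))) \<partial>lborel)"
proof -
  let ?c = "convol (\<lambda>u. f u * cis (- (u \<bullet> (2 *\<^sub>R \<xi>)))) (\<lambda>v. cnj (f v)) (2 *\<^sub>R x)"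
  have "ennreal (cmod ?c)
      \<le> (\<integral>\<^sup>+ u. ennreal (cmod (f u) * cmod (f (2 *\<^sub>R x - u))) \<partial>lborel)"
    unfolding convol_def by (rule order_trans[OF norm_integral_le_nn_integral]) (simp add: norm_mult)
  then have "ennreal (2 ^ DIM('a)) * ennreal (cmod ?c)
      \<le> ennreal (2 ^ DIM('a)) * (\<integral>\<^sup>+ u. ennreal (cmod (f u) * cmod (f (2 *\<^sub>R x - u))) \<partial>lborel)"
    by (rule mult_left_mono) simp
  then show ?thesis
    unfolding Wig_eq_convol[OF assms] by (subst ennreal_mult) auto
qed

text \<open>The convolution in \<open>Wig_eq_convol\<close> is transferred to the Fourier side,
  where it becomes the same midpoint integral for \<open>fourier f\<close> centred at
  \<open>\<xi>\<close>. \<open>Wig_le\<close> sees only \<open>x\<close> and this bound only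
  \<open>\<xi>\<close>, so that together they control both variables.\<close>

lemma Wig_le_fourier:
  fixes f :: "'a::euclidean_space \<Rightarrow> complex"
  assumes f: "integrable lborel f" "continuous_on UNIV f" "\<And>x. cmod (f x) \<le> B"
  shows "ennreal (cmod (Wig f (x, \<xi>))) * ennreal ((2 * pi) ^ DIM('a))
    \<le> ennreal (2 ^ DIM('a)) *
      (\<integral>\<^sup>+ u. ennreal (cmod (fourier f u) * cmod (fourier f (2 *\<^sub>R \<xi> - u))) \<partial>lborel)"
proof -
  have [measurable]: "f \<in> borel_measurable borel" using f by auto
  let ?F = "\<lambda>u. f u * cis (- (u \<bullet> (2 *\<^sub>R \<xi>)))"
  let ?c = "convol ?F (\<lambda>v. cnj (f v)) (2 *\<^sub>R x)"
  have F: "integrable lborel ?F"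
    by (rule Bochner_Integration.integrable_bound[OF f(1)]) (auto simp: norm_mult)
  have "ennreal (cmod ?c) * ennreal ((2 * pi) ^ DIM('a))
    \<le> (\<integral>\<^sup>+ \<zeta>. ennreal (cmod (fourier ?F \<zeta>) * cmod (fourier (\<lambda>v. cnj (f v)) \<zeta>)) \<partial>lborel)"
    by (rule norm_convol_le_fourier[where B=B])
       (use F f in \<open>auto simp: norm_mult intro!: continuous_intros\<close>)
  \<comment> \<open>Modulation shifts the argument by \<open>2 *\<^sub>R \<xi>\<close> and
    conjugation reflects it; writing \<open>0 - \<zeta>\<close> prepares the reflection about the
    origin.\<close>
  also have "\<dots> = (\<integral>\<^sup>+ \<zeta>. ennreal (cmod (fourier f (2 *\<^sub>R \<xi> - (0 - \<zeta>))) * cmod (fourier f (0 - \<zeta>))) \<partial>lborel)"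
    by (simp only: fourier_modulate fourier_cnj complex_mod_cnj) (simp add: add.commute)
  also have "\<dots> = (\<integral>\<^sup>+ u. ennreal (cmod (fourier f u) * cmod (fourier f (2 *\<^sub>R \<xi> - u))) \<partial>lborel)"
    by (subst nn_integral_lborel_reflect[of "\<lambda>u. ennreal (cmod (fourier f (2 *\<^sub>R \<xi> - u)) * cmod (fourier f u))" 0])
       (simp_all add: mult.commute)
  finally have "ennreal (2 ^ DIM('a)) * (ennreal (cmod ?c) * ennreal ((2 * pi) ^ DIM('a)))
    \<le> ennreal (2 ^ DIM('a)) *
      (\<integral>\<^sup>+ u. ennreal (cmod (fourier f u) * cmod (fourier f (2 *\<^sub>R \<xi> - u))) \<partial>lborel)"
    by (rule mult_left_mono) simp
  then show ?thesis
    unfolding Wig_eq_convol[OF \<open>f \<in> borel_measurable borel\<close>]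
    by (subst ennreal_mult) (auto simp: mult.assoc)
qed

section \<open>The short-time Fourier transform and bounds replacing its inversion formula\<close>

lemma norm_fourier_le: "ennreal (cmod (fourier h \<zeta>)) \<le> (\<integral>\<^sup>+ x. ennreal (cmod (h x)) \<partial>lborel)"
  unfolding fourier_def by (rule order_trans[OF norm_integral_le_nn_integral]) (simp add: norm_mult)

text \<open>For fixed \<open>x\<close> the STFT is a Fourier transform in \<open>y\<close>, which
  leads back to \<open>f\<close>; for fixed \<open>\<xi>\<close> it is, by the next lemma, a
  convolution in \<open>x\<close>, whose Fourier transform contains
  \<open>fourier f\<close>.\<close>

lemma STFT_eq_fourier: "STFT g f (x, \<xi>) = fourier (\<lambda>y. f y * cnj (g (y - x))) \<xi>"
  by (simp add: STFT_def fourier_def mult_ac)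

lemma STFT_eq_convol:
  "STFT g f (x, \<xi>) = convol (\<lambda>y. f y * cis (- (y \<bullet> \<xi>))) (\<lambda>t. cnj (g (- t))) x"
  by (simp add: STFT_def convol_def mult_ac)

text \<open>\<open>norm_le_fourier_L1\<close> applied to the windowed function
  \<open>f y * cnj (g (y - x))\<close>, whose Fourier transform is
  \<open>STFT g f (x, \<xi>)\<close>.\<close>

lemma mult_le_integral_STFT:
  fixes f g :: "'a::euclidean_space \<Rightarrow> complex"
  assumes f: "integrable lborel f" "continuous_on UNIV f" "\<And>x. cmod (f x) \<le> B"
    and g: "continuous_on UNIV g" "\<And>x. cmod (g x) \<le> C"
  shows "ennreal (cmod (f y) * cmod (g (y - x))) * ennreal ((2 * pi) ^ DIM('a))
    \<le> (\<integral>\<^sup>+ \<xi>. ennreal (cmod (STFT g f (x, \<xi>))) \<partial>lborel)"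
proof -
  have [measurable]: "f \<in> borel_measurable borel" "g \<in> borel_measurable borel"
    using f g by (auto intro: borel_measurable_continuous_onI)
  let ?h = "\<lambda>y. f y * cnj (g (y - x))"
  have C: "0 \<le> C" using g(2)[of 0] norm_ge_zero[of "g 0"] by linarith
  have B: "0 \<le> B" using f(3)[of 0] norm_ge_zero[of "f 0"] by linarith
  have h: "integrable lborel ?h"
    by (rule Bochner_Integration.integrable_bound[of _ "\<lambda>y. f y * complex_of_real C"])
       (use f g C in \<open>auto simp: norm_mult intro!: mult_left_mono\<close>)
  have c: "continuous_on UNIV ?h"
    by (intro continuous_intros f(2) continuous_on_compose2[OF g(1)]) auto
  have b: "cmod (?h y) \<le> B * C" for y
    using f(3) g(2) B C by (auto simp: norm_mult intro!: mult_mono)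
  show ?thesis
    using norm_le_fourier_L1[OF h b c, of y] by (simp add: STFT_eq_fourier norm_mult)
qed

text \<open>The Fourier transform of \<open>STFT g f (x, \<xi>)\<close> in \<open>x\<close>, taken
  at \<open>\<eta> - \<xi>\<close>, is the product of \<open>fourier f \<eta>\<close> and
  \<open>cnj (fourier g (\<eta> - \<xi>))\<close>. Only the trivial bound of a transform by the L^1
  norm is used, so no power of 2 pi arises.\<close>

lemma fourier_mult_le_integral_STFT:
  fixes f g :: "'a::euclidean_space \<Rightarrow> complex"
  assumes f: "integrable lborel f" and g: "integrable lborel g"
  shows "ennreal (cmod (fourier f \<eta>) * cmod (fourier g (\<eta> - \<xi>)))
    \<le> (\<integral>\<^sup>+ x. ennreal (cmod (STFT g f (x, \<xi>))) \<partial>lborel)"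
proof -
  have [measurable]: "f \<in> borel_measurable borel" "g \<in> borel_measurable borel"
    using f g by auto
  have F: "integrable lborel (\<lambda>y. f y * cis (- (y \<bullet> \<xi>)))"
    by (rule Bochner_Integration.integrable_bound[OF f]) (auto simp: norm_mult)
  have G: "integrable lborel (\<lambda>t. cnj (g (- t)))"
    using integrable_lborel_reflect[OF g, of 0] by simp
  have "fourier (\<lambda>x. STFT g f (x, \<xi>)) (\<eta> - \<xi>) = fourier f \<eta> * cnj (fourier g (\<eta> - \<xi>))"
    unfolding STFT_eq_convol fourier_convol[OF F G] fourier_modulate fourier_involution[OF \<open>g \<in> borel_measurable borel\<close>]
    by simp
  then show ?thesis
    using norm_fourier_le[of "\<lambda>x. STFT g f (x, \<xi>)" "\<eta> - \<xi>"] by (simp add: norm_mult)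
qed

text \<open>The convolution of \<open>g\<close> with \<open>\<lambda>t. cnj (g (- t))\<close> takes
  the squared L^2 norm as its value at 0 and has the squared modulus of \<open>fourier g\<close> as
  its Fourier transform, so the bound for convolutions gives this half of Plancherel's
  theorem.\<close>

lemma Plancherel_le:
  fixes g :: "'a::euclidean_space \<Rightarrow> complex"
  assumes g: "integrable lborel g" "continuous_on UNIV g" "\<And>x. cmod (g x) \<le> C"
  shows "(\<integral>\<^sup>+ x. ennreal ((cmod (g x))\<^sup>2) \<partial>lborel) * ennreal ((2 * pi) ^ DIM('a))
    \<le> (\<integral>\<^sup>+ \<xi>. ennreal ((cmod (fourier g \<xi>))\<^sup>2) \<partial>lborel)"
proof -
  have [measurable]: "g \<in> borel_measurable borel" using g by auto
  have G: "integrable lborel (\<lambda>t. cnj (g (- t)))"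
    using integrable_lborel_reflect[OF g(1), of 0] by simp
  have C: "0 \<le> C" using g(3)[of 0] norm_ge_zero[of "g 0"] by linarith
  have int: "integrable lborel (\<lambda>x. (cmod (g x))\<^sup>2)"
    by (rule Bochner_Integration.integrable_bound[of _ "\<lambda>y. complex_of_real C * g y"])
       (use g C in \<open>auto simp: norm_mult power2_eq_square intro!: mult_right_mono\<close>)
  have "convol g (\<lambda>t. cnj (g (- t))) 0 = (LINT x|lborel. complex_of_real ((cmod (g x))\<^sup>2))"
    by (simp only: convol_def complex_norm_square diff_0 minus_minus)
  then have "convol g (\<lambda>t. cnj (g (- t))) 0 = complex_of_real (LINT x|lborel. (cmod (g x))\<^sup>2)"
    by (simp only: integral_complex_of_real)
  then have "ennreal (cmod (convol g (\<lambda>t. cnj (g (- t))) 0)) = (\<integral>\<^sup>+ x. ennreal ((cmod (g x))\<^sup>2) \<partial>lborel)"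
    using int by (simp add: nn_integral_eq_integral)
  then show ?thesis
    using norm_convol_le_fourier[OF g G, of 0]
    by (simp add: fourier_involution power2_eq_square)
qed

text \<open>Multiplying \<open>mult_le_integral_STFT\<close> by \<open>cmod (g (y - x))\<close> and
  integrating over \<open>x\<close> produces the squared L^2 norm of \<open>g\<close> on the left
  and an integral over the whole plane on the right.\<close>

lemma STFT_inversion_bound:
  fixes f g :: "'a::euclidean_space \<Rightarrow> complex"
  assumes f: "integrable lborel f" "continuous_on UNIV f" "\<And>x. cmod (f x) \<le> B"
    and g: "continuous_on UNIV g" "\<And>x. cmod (g x) \<le> C"
  shows "ennreal (cmod (f y)) * (\<integral>\<^sup>+ x. ennreal ((cmod (g x))\<^sup>2) \<partial>lborel) * ennreal ((2 * pi) ^ DIM('a))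
    \<le> (\<integral>\<^sup>+ z. ennreal (cmod (STFT g f z) * cmod (g (y - fst z))) \<partial>lborel)"
proof -
  have [measurable]: "f \<in> borel_measurable borel" "g \<in> borel_measurable borel"
    using f g by (auto intro: borel_measurable_continuous_onI)
  let ?c = "ennreal ((2 * pi) ^ DIM('a))"
  have "ennreal (cmod (f y)) * (\<integral>\<^sup>+ x. ennreal ((cmod (g x))\<^sup>2) \<partial>lborel) * ?c
     = ennreal (cmod (f y)) * (\<integral>\<^sup>+ x. ennreal ((cmod (g (y - x)))\<^sup>2) \<partial>lborel) * ?c"
    by (subst nn_integral_lborel_reflect[of "\<lambda>x. ennreal ((cmod (g x))\<^sup>2)"]) auto
  also have "\<dots> = (\<integral>\<^sup>+ x. ennreal (cmod (f y) * cmod (g (y - x))) * ?c * ennreal (cmod (g (y - x))) \<partial>lborel)"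
    by (simp add: nn_integral_cmult[symmetric] nn_integral_multc[symmetric] ennreal_mult power2_eq_square mult_ac)
  also have "\<dots> \<le> (\<integral>\<^sup>+ x. (\<integral>\<^sup>+ \<xi>. ennreal (cmod (STFT g f (x, \<xi>))) \<partial>lborel) * ennreal (cmod (g (y - x))) \<partial>lborel)"
    by (intro nn_integral_mono mult_right_mono mult_le_integral_STFT[OF f g]) auto
  also have "\<dots> = (\<integral>\<^sup>+ x. (\<integral>\<^sup>+ \<xi>. ennreal (cmod (STFT g f (x, \<xi>)) * cmod (g (y - x))) \<partial>lborel) \<partial>lborel)"
    by (simp add: nn_integral_multc[symmetric] ennreal_mult borel_prod)
  also have "\<dots> = (\<integral>\<^sup>+ z. ennreal (cmod (STFT g f z) * cmod (g (y - fst z))) \<partial>lborel)"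
    unfolding lborel_prod[symmetric] by (subst lborel.nn_integral_fst[symmetric]) (auto simp: lborel_prod)
  finally show ?thesis .
qed

text \<open>The same integration in \<open>\<xi>\<close> yields the squared L^2 norm of
  \<open>fourier g\<close>; \<open>Plancherel_le\<close> replaces it by that of \<open>g\<close> and
  supplies the factor \<open>(2 * pi) ^ DIM('a)\<close>.\<close>

lemma STFT_inversion_bound_fourier:
  fixes f g :: "'a::euclidean_space \<Rightarrow> complex"
  assumes f: "integrable lborel f"
    and g: "integrable lborel g" "continuous_on UNIV g" "\<And>x. cmod (g x) \<le> C"
  shows "ennreal (cmod (fourier f \<eta>)) * (\<integral>\<^sup>+ x. ennreal ((cmod (g x))\<^sup>2) \<partial>lborel) * ennreal ((2 * pi) ^ DIM('a))
    \<le> (\<integral>\<^sup>+ z. ennreal (cmod (STFT g f z) * cmod (fourier g (\<eta> - snd z))) \<partial>lborel)"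
proof -
  have [measurable]: "f \<in> borel_measurable borel" "g \<in> borel_measurable borel"
    using f g by auto
  have "ennreal (cmod (fourier f \<eta>)) * (\<integral>\<^sup>+ x. ennreal ((cmod (g x))\<^sup>2) \<partial>lborel) * ennreal ((2 * pi) ^ DIM('a))
     \<le> ennreal (cmod (fourier f \<eta>)) * (\<integral>\<^sup>+ x. ennreal ((cmod (fourier g x))\<^sup>2) \<partial>lborel)"
    unfolding mult.assoc by (intro mult_left_mono Plancherel_le[OF g]) auto
  also have "\<dots> = ennreal (cmod (fourier f \<eta>)) * (\<integral>\<^sup>+ x. ennreal ((cmod (fourier g (\<eta> - x)))\<^sup>2) \<partial>lborel)"
    by (subst nn_integral_lborel_reflect[of "\<lambda>x. ennreal ((cmod (fourier g x))\<^sup>2)"]) auto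
  also have "\<dots> = (\<integral>\<^sup>+ \<xi>. ennreal (cmod (fourier f \<eta>) * cmod (fourier g (\<eta> - \<xi>))) * ennreal (cmod (fourier g (\<eta> - \<xi>))) \<partial>lborel)"
    by (simp add: nn_integral_cmult[symmetric] ennreal_mult power2_eq_square mult_ac)
  also have "\<dots> \<le> (\<integral>\<^sup>+ \<xi>. (\<integral>\<^sup>+ x. ennreal (cmod (STFT g f (x, \<xi>))) \<partial>lborel) * ennreal (cmod (fourier g (\<eta> - \<xi>))) \<partial>lborel)"
    by (intro nn_integral_mono mult_right_mono fourier_mult_le_integral_STFT f g) auto
  also have "\<dots> = (\<integral>\<^sup>+ \<xi>. (\<integral>\<^sup>+ x. ennreal (cmod (STFT g f (x, \<xi>)) * cmod (fourier g (\<eta> - \<xi>))) \<partial>lborel) \<partial>lborel)"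
    by (simp add: nn_integral_multc[symmetric] ennreal_mult borel_prod)
  also have "\<dots> = (\<integral>\<^sup>+ z. ennreal (cmod (STFT g f z) * cmod (fourier g (\<eta> - snd z))) \<partial>lborel)"
    unfolding lborel_prod[symmetric] by (subst lborel_pair.nn_integral_snd[symmetric]) (auto simp: lborel_prod)
  finally show ?thesis .
qed


section \<open>Weighted estimates\<close>

lemma weight_functionD:
  assumes "weight_function \<omega> K b"
  shows weight_mono: "0 \<le> s \<Longrightarrow> s \<le> t \<Longrightarrow> \<omega> s \<le> \<omega> t"
    and weight_nonneg: "0 \<le> t \<Longrightarrow> 0 \<le> \<omega> t"
    and weight_K: "1 \<le> K"
    and weight_double: "0 \<le> t \<Longrightarrow> \<omega> (2 * t) \<le> K * (1 + \<omega> t)"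
    and weight_b: "0 < b"
  using assms by (auto simp: weight_function_def mono_on_def)

text \<open>Since \<open>s + t \<le> 2 * max s t\<close>, monotonicity and the doubling condition
  replace subadditivity; the weight of the maximum is at most the sum because weights are
  nonnegative.\<close>

lemma weight_subadditive:
  assumes w: "weight_function \<omega> K b" and "0 \<le> u" "0 \<le> s" "0 \<le> t" "u \<le> s + t"
  shows "\<omega> u \<le> K * (1 + \<omega> s + \<omega> t)"
proof -
  have "\<omega> u \<le> \<omega> (2 * max s t)" using assms by (intro weight_mono[OF w]) auto
  also have "\<dots> \<le> K * (1 + \<omega> (max s t))" using assms by (intro weight_double[OF w]) auto
  also have "\<dots> \<le> K * (1 + \<omega> s + \<omega> t)"
    using weight_K[OF w] weight_nonneg[OF w, of s] weight_nonneg[OF w, of t] assms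
    by (intro mult_left_mono) (auto simp: max_def)
  finally show ?thesis .
qed

text \<open>A mean is at most the maximum, so monotonicity suffices and no doubling constant is
  lost.\<close>

lemma weight_midpoint:
  assumes w: "weight_function \<omega> K b"
  shows "\<omega> (norm x) \<le> \<omega> (norm u) + \<omega> (norm (2 *\<^sub>R x - u))"
proof -
  have "norm (2 *\<^sub>R x) \<le> norm u + norm (2 *\<^sub>R x - u)"
    using norm_triangle_ineq[of u "2 *\<^sub>R x - u"] by simp
  then have "norm x \<le> max (norm u) (norm (2 *\<^sub>R x - u))" by auto
  then have "\<omega> (norm x) \<le> \<omega> (max (norm u) (norm (2 *\<^sub>R x - u)))"
    by (intro weight_mono[OF w]) auto
  then show ?thesis
    using weight_nonneg[OF w, of "norm u"] weight_nonneg[OF w, of "norm (2 *\<^sub>R x - u)"]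
    by (auto simp: max_def split: if_splits)
qed

lemma weight_measurable:
  assumes w: "weight_function \<omega> K b"
  shows "(\<lambda>z :: 'a::euclidean_space. \<omega> (norm z)) \<in> borel_measurable borel"
proof (intro borel_measurable_continuous_onI)
  have "continuous_on {0..} \<omega>" using w by (simp add: weight_function_def)
  then show "continuous_on UNIV (\<lambda>z :: 'a. \<omega> (norm z))"
    by (rule continuous_on_compose2) (auto intro!: continuous_intros)
qed

lemma exp_weight_measurable:
  assumes w: "weight_function \<omega> K b"
  shows "(\<lambda>z :: 'a::euclidean_space. exp (l * \<omega> (norm z))) \<in> borel_measurable borel"
  using weight_measurable[OF w] by measurable

section \<open>Weighted norms and pointwise bounds for test functions\<close>

lemma weighted_norm_top:
  "weighted_norm top \<omega> l F = esssup lborel (\<lambda>z. ennreal (exp (l * \<omega> (norm z)) * norm (F z)))"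
  by (simp add: weighted_norm_def L_norm_top)

lemma AE_le_weighted_norm_top:
  "AE z in lborel. ennreal (exp (l * \<omega> (norm z)) * norm (F z)) \<le> weighted_norm top \<omega> l F"
  unfolding weighted_norm_top by (rule esssup_AE)

lemma weighted_norm_mono:
  fixes F :: "'a::euclidean_space \<Rightarrow> complex"
  assumes w: "weight_function \<omega> K b" and q: "1 \<le> q" and [measurable]: "F \<in> borel_measurable borel"
    and l: "l \<le> l'"
  shows "weighted_norm q \<omega> l F \<le> weighted_norm q \<omega> l' F"
proof -
  note [measurable] = exp_weight_measurable[OF w]
  have "L_norm q (\<lambda>z. exp (l * \<omega> (norm z)) *\<^sub>R F z)
      \<le> ennreal 1 * L_norm q (\<lambda>z. exp (l' * \<omega> (norm z)) *\<^sub>R F z)"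
  proof (intro L_norm_mono q AE_I2)
    fix z :: 'a
    have "l * \<omega> (norm z) \<le> l' * \<omega> (norm z)"
      using l weight_nonneg[OF w, of "norm z"] by (intro mult_right_mono) auto
    then have "exp (l * \<omega> (norm z)) * cmod (F z) \<le> exp (l' * \<omega> (norm z)) * cmod (F z)"
      by (intro mult_right_mono) auto
    then show "norm (exp (l * \<omega> (norm z)) *\<^sub>R F z)
        \<le> 1 * norm (exp (l' * \<omega> (norm z)) *\<^sub>R F z)" by simp
  qed auto
  then show ?thesis by (simp add: weighted_norm_def)
qed

text \<open>The exceptional set is open and of measure zero, hence empty. This turns bounds by
  essential suprema into pointwise bounds.\<close>

lemma continuous_AE_le:
  fixes f :: "'a::euclidean_space \<Rightarrow> complex"
  assumes "continuous_on UNIV f" "AE x in lborel. cmod (f x) \<le> c"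
  shows "cmod (f x) \<le> c"
proof -
  have "closed {x. cmod (f x) \<le> c}"
    by (intro closed_Collect_le continuous_intros assms)
  moreover have "AE x in lebesgue. x \<in> {x. cmod (f x) \<le> c}"
    using AE_completion[OF assms(2)] by simp
  ultimately show ?thesis using mem_closed_if_AE_lebesgue by blast
qed

lemma smooth_continuous_on: "smooth f \<Longrightarrow> continuous_on UNIV f"
  unfolding smooth_def
  by (auto simp: iterated_deriv_def dest!: bspec[of _ _ "[]"] intro: differentiable_imp_continuous_on)

lemma S_spaceD:
  fixes f :: "'a::euclidean_space \<Rightarrow> complex"
  assumes w: "weight_function \<omega> K b" and f: "f \<in> S_space \<omega>"
  shows S_space_integrable: "integrable lborel f"
    and S_space_continuous: "continuous_on UNIV f"
    and S_space_fourier_continuous: "continuous_on UNIV (fourier f)"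
    and S_space_bounded: "\<exists>B. \<forall>x. cmod (f x) \<le> B"
proof -
  show "integrable lborel f" using f by (simp add: S_space_def)
  show cont: "continuous_on UNIV f" "continuous_on UNIV (fourier f)"
    using f by (auto simp: S_space_def intro: smooth_continuous_on)
  \<comment> \<open>The empty list of directions gives \<open>f\<close> itself, and the weight
    \<open>exp (1 * \<omega> (norm x))\<close> is at least 1.\<close>
  have "weighted_norm \<infinity> \<omega> 1 (iterated_deriv [] f) < \<infinity>"
    using f by (auto simp: S_space_def)
  then obtain B where B: "weighted_norm top \<omega> 1 f = ennreal B" "B \<ge> 0"
    by (cases "weighted_norm top \<omega> 1 f") (auto simp: iterated_deriv_def)
  have "AE x in lborel. cmod (f x) \<le> B"
    using AE_le_weighted_norm_top[of 1 \<omega> f]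
  proof eventually_elim
    case (elim x)
    have "1 * cmod (f x) \<le> exp (1 * \<omega> (norm x)) * cmod (f x)"
      using weight_nonneg[OF w, of "norm x"] by (intro mult_right_mono) auto
    also have "\<dots> \<le> B" using elim B by simp
    finally show ?case by simp
  qed
  then show "\<exists>B. \<forall>x. cmod (f x) \<le> B" using continuous_AE_le[OF cont(1)] by blast
qed

section \<open>Weighted bounds for convolutions and for the Wigner transform\<close>

lemma weighted_convolution_le:
  fixes \<sigma> \<phi> :: "'a::euclidean_space \<Rightarrow> complex"
  assumes w: "weight_function \<omega> K b" and p: "1 \<le> p" and l: "0 \<le> l"
    and [measurable]: "\<sigma> \<in> borel_measurable borel" "\<phi> \<in> borel_measurable borel"
  shows "ennreal (exp (l * \<omega> (norm z)) * cmod (convolution (functional_of \<sigma>) \<phi> z))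
    \<le> ennreal (exp (K * l)) * weighted_norm (conj_exponent p) \<omega> (K * l) \<sigma> * weighted_norm p \<omega> (K * l) \<phi>"
proof -
  note [measurable] = exp_weight_measurable[OF w]
  let ?e = "\<lambda>v::'a. exp (K * l * \<omega> (norm v))"
  \<comment> \<open>\<open>weight_subadditive\<close> for \<open>z = v + (z - v)\<close>; the
    summand 1 is the source of the factor \<open>exp (K * l)\<close>.\<close>
  have pt: "exp (l * \<omega> (norm z)) \<le> exp (K * l) * (?e v * ?e (z - v))" for v
  proof -
    have "\<omega> (norm z) \<le> K * (1 + \<omega> (norm v) + \<omega> (norm (z - v)))"
      using norm_triangle_ineq[of v "z - v"] by (intro weight_subadditive[OF w]) auto
    then have "l * \<omega> (norm z) \<le> l * (K * (1 + \<omega> (norm v) + \<omega> (norm (z - v))))"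
      using l by (rule mult_left_mono)
    then show ?thesis by (simp add: exp_add[symmetric] algebra_simps)
  qed
  have "ennreal (exp (l * \<omega> (norm z)) * cmod (convolution (functional_of \<sigma>) \<phi> z))
     \<le> ennreal (exp (l * \<omega> (norm z))) * (\<integral>\<^sup>+ v. ennreal (cmod (\<sigma> v * \<phi> (z - v))) \<partial>lborel)"
    unfolding Defs.convolution_def functional_of_def
    by (subst ennreal_mult) (auto intro!: mult_left_mono norm_integral_le_nn_integral)
  also have "\<dots> = (\<integral>\<^sup>+ v. ennreal (exp (l * \<omega> (norm z)) * cmod (\<sigma> v * \<phi> (z - v))) \<partial>lborel)"
    by (simp add: nn_integral_cmult[symmetric] ennreal_mult)
  also have "\<dots> \<le> (\<integral>\<^sup>+ v. ennreal (exp (K * l)) *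
      ennreal (norm (?e v *\<^sub>R \<sigma> v) * norm (?e (z - v) *\<^sub>R \<phi> (z - v))) \<partial>lborel)"
  proof (intro nn_integral_mono)
    fix v
    have "exp (l * \<omega> (norm z)) * (cmod (\<sigma> v) * cmod (\<phi> (z - v)))
       \<le> exp (K * l) * (?e v * ?e (z - v)) * (cmod (\<sigma> v) * cmod (\<phi> (z - v)))"
      by (intro mult_right_mono pt) auto
    then show "ennreal (exp (l * \<omega> (norm z)) * cmod (\<sigma> v * \<phi> (z - v)))
      \<le> ennreal (exp (K * l)) * ennreal (norm (?e v *\<^sub>R \<sigma> v) * norm (?e (z - v) *\<^sub>R \<phi> (z - v)))"
      by (simp add: ennreal_mult[symmetric] norm_mult mult_ac)
  qed
  also have "\<dots> = ennreal (exp (K * l)) *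
      (\<integral>\<^sup>+ v. ennreal (norm (?e (z - v) *\<^sub>R \<phi> (z - v)) * norm (?e v *\<^sub>R \<sigma> v)) \<partial>lborel)"
    by (subst nn_integral_cmult) (auto simp: mult.commute)
  also have "\<dots> \<le> ennreal (exp (K * l)) *
     (L_norm p (\<lambda>v. ?e (z - v) *\<^sub>R \<phi> (z - v)) * L_norm (conj_exponent p) (\<lambda>v. ?e v *\<^sub>R \<sigma> v))"
    by (intro mult_left_mono Hoelder_L_norm p) auto
  also have "\<dots> \<le> ennreal (exp (K * l)) *
     (L_norm p (\<lambda>v. ?e v *\<^sub>R \<phi> v) * L_norm (conj_exponent p) (\<lambda>v. ?e v *\<^sub>R \<sigma> v))"
    using L_norm_reflect[OF p, of "\<lambda>v. ?e v *\<^sub>R \<phi> v" z]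
    by (intro mult_left_mono mult_right_mono) auto
  finally show ?thesis by (simp add: weighted_norm_def mult_ac)
qed

lemma weighted_norm_convolution_le:
  fixes \<sigma> \<phi> :: "'a::euclidean_space \<Rightarrow> complex"
  assumes w: "weight_function \<omega> K b" and p: "1 \<le> p" and l: "0 \<le> l"
    and [measurable]: "\<sigma> \<in> borel_measurable borel" "\<phi> \<in> borel_measurable borel"
  shows "weighted_norm top \<omega> l (convolution (functional_of \<sigma>) \<phi>)
    \<le> ennreal (exp (K * l)) * weighted_norm (conj_exponent p) \<omega> (K * l) \<sigma> * weighted_norm p \<omega> (K * l) \<phi>"
proof -
  note [measurable] = exp_weight_measurable[OF w]
  have [measurable]: "\<sigma> \<in> borel_measurable lborel" by simp
  have [measurable]: "convolution (functional_of \<sigma>) \<phi> \<in> borel_measurable borel"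
    unfolding Defs.convolution_def[abs_def] functional_of_def by measurable
  show ?thesis unfolding weighted_norm_top
    by (intro esssup_I AE_I2 weighted_convolution_le[OF w p l]) auto
qed

text \<open>Used for \<open>f\<close> and for \<open>fourier f\<close>. The midpoint inequality puts
  the weight \<open>a\<close> on each factor, Hoelder's inequality separates them, and the
  reflection of \<open>u\<close> about \<open>x\<close> does not increase the norm.\<close>

lemma weighted_midpoint_le:
  fixes h :: "'a::euclidean_space \<Rightarrow> complex"
  assumes w: "weight_function \<omega> K b" and p: "1 \<le> p" and a: "0 \<le> a"
    and [measurable]: "h \<in> borel_measurable borel"
  shows "ennreal (exp (a * \<omega> (norm x))) * (\<integral>\<^sup>+ u. ennreal (cmod (h u) * cmod (h (2 *\<^sub>R x - u))) \<partial>lborel)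
    \<le> weighted_norm p \<omega> a h * weighted_norm (conj_exponent p) \<omega> a h"
proof -
  note [measurable] = exp_weight_measurable[OF w]
  let ?e = "\<lambda>v::'a. exp (a * \<omega> (norm v))"
  have "ennreal (?e x) * (\<integral>\<^sup>+ u. ennreal (cmod (h u) * cmod (h (2 *\<^sub>R x - u))) \<partial>lborel)
     = (\<integral>\<^sup>+ u. ennreal (?e x * (cmod (h u) * cmod (h (2 *\<^sub>R x - u)))) \<partial>lborel)"
    by (subst nn_integral_cmult[symmetric]) (auto simp: ennreal_mult)
  also have "\<dots> \<le> (\<integral>\<^sup>+ u. ennreal (norm (?e u *\<^sub>R h u) * norm (?e (2 *\<^sub>R x - u) *\<^sub>R h (2 *\<^sub>R x - u))) \<partial>lborel)"
  proof (intro nn_integral_mono ennreal_leI)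
    fix u
    have "a * \<omega> (norm x) \<le> a * (\<omega> (norm u) + \<omega> (norm (2 *\<^sub>R x - u)))"
      by (intro mult_left_mono weight_midpoint[OF w] a)
    then have "?e x \<le> ?e u * ?e (2 *\<^sub>R x - u)"
      by (simp add: exp_add[symmetric] algebra_simps)
    then have "?e x * (cmod (h u) * cmod (h (2 *\<^sub>R x - u)))
        \<le> ?e u * ?e (2 *\<^sub>R x - u) * (cmod (h u) * cmod (h (2 *\<^sub>R x - u)))"
      by (intro mult_right_mono) auto
    then show "?e x * (cmod (h u) * cmod (h (2 *\<^sub>R x - u)))
        \<le> norm (?e u *\<^sub>R h u) * norm (?e (2 *\<^sub>R x - u) *\<^sub>R h (2 *\<^sub>R x - u))"
      by (simp add: mult_ac)
  qed
  also have "\<dots> \<le> L_norm p (\<lambda>u. ?e u *\<^sub>R h u) * L_norm (conj_exponent p) (\<lambda>u. ?e (2 *\<^sub>R x - u) *\<^sub>R h (2 *\<^sub>R x - u))"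
    by (intro Hoelder_L_norm p) auto
  also have "\<dots> \<le> L_norm p (\<lambda>u. ?e u *\<^sub>R h u) * L_norm (conj_exponent p) (\<lambda>u. ?e u *\<^sub>R h u)"
    by (intro mult_left_mono L_norm_reflect[of _ "\<lambda>u. ?e u *\<^sub>R h u" "2 *\<^sub>R x"] conj_exponent_ge_1) auto
  finally show ?thesis by (simp add: weighted_norm_def)
qed

text \<open>\<open>cmod (Rihaczek f (x, \<xi>))\<close> is the tensor product of
  \<open>cmod (f x)\<close> and \<open>cmod (fourier f \<xi>)\<close>. Since \<open>\<omega>\<close>
  at either component is at most \<open>\<omega>\<close> at the pair, two weights \<open>a\<close>
  are absorbed by one weight \<open>2 * a\<close>.\<close>

lemma weighted_norm_Rihaczek_ge:
  fixes f :: "'a::euclidean_space \<Rightarrow> complex"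
  assumes w: "weight_function \<omega> K b" and q: "1 \<le> q" and a: "0 \<le> a"
    and [measurable]: "f \<in> borel_measurable borel"
  shows "weighted_norm q \<omega> a f * weighted_norm q \<omega> a (fourier f) \<le> weighted_norm q \<omega> (2 * a) (Rihaczek f)"
proof -
  note [measurable] = exp_weight_measurable[OF w]
  let ?e = "\<lambda>v::'a. exp (a * \<omega> (norm v))"
  let ?T = "\<lambda>(x, \<xi>). norm (?e x *\<^sub>R f x) * norm (?e \<xi> *\<^sub>R fourier f \<xi>)"
  have "L_norm q (\<lambda>x. ?e x *\<^sub>R f x) * L_norm q (\<lambda>\<xi>. ?e \<xi> *\<^sub>R fourier f \<xi>) \<le> L_norm q ?T"
    by (intro L_norm_tensor q) auto
  also have "\<dots> \<le> ennreal 1 * L_norm q (\<lambda>z. exp (2 * a * \<omega> (norm z)) *\<^sub>R Rihaczek f z)"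
  proof (intro L_norm_mono q AE_I2)
    show "(\<lambda>x. norm (?T x)) \<in> borel_measurable borel" unfolding borel_prod[symmetric] by measurable
    fix z :: "'a \<times> 'a"
    obtain x \<xi> where z: "z = (x, \<xi>)" by (cases z)
    have "a * \<omega> (norm x) \<le> a * \<omega> (norm z)" "a * \<omega> (norm \<xi>) \<le> a * \<omega> (norm z)"
      unfolding z using norm_fst_le[of x \<xi>] norm_snd_le[of \<xi> x]
      by (intro mult_left_mono a weight_mono[OF w]; simp)+
    then have "?e x * ?e \<xi> \<le> exp (2 * a * \<omega> (norm z))"
      by (simp add: exp_add[symmetric])
    then have "?e x * ?e \<xi> * (cmod (f x) * cmod (fourier f \<xi>))
        \<le> exp (2 * a * \<omega> (norm z)) * (cmod (f x) * cmod (fourier f \<xi>))"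
      by (intro mult_right_mono) auto
    then show "norm (?T z) \<le> 1 * norm (exp (2 * a * \<omega> (norm z)) *\<^sub>R Rihaczek f z)"
      by (simp add: z Rihaczek_def norm_mult mult_ac)
  qed auto
  finally show ?thesis by (simp add: weighted_norm_def)
qed

lemma ennreal_le_of_mult_le:
  assumes "x * ennreal c \<le> y" "c > 0"
  shows "x \<le> ennreal (1 / c) * y"
proof -
  have "x = ennreal (1 / c) * (x * ennreal c)"
    using assms(2) by (simp add: mult.left_commute ennreal_mult[symmetric])
  also have "\<dots> \<le> ennreal (1 / c) * y" using assms(1) by (rule mult_left_mono) simp
  finally show ?thesis .
qed

text \<open>The bound through \<open>f\<close> carries a weight in \<open>x\<close>, the one through
  \<open>fourier f\<close> a weight in \<open>\<xi>\<close>; their product bounds the square of the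
  transform with a weight in both variables.\<close>

lemma weighted_Wig_le:
  fixes f :: "'a::euclidean_space \<Rightarrow> complex"
  assumes w: "weight_function \<omega> K b" and p: "1 \<le> p" and s: "0 \<le> s"
    and f: "integrable lborel f" "continuous_on UNIV f" "\<And>x. cmod (f x) \<le> B"
  shows "(ennreal (exp (s * \<omega> (norm z)) * cmod (Wig f z)))\<^sup>2
    \<le> ennreal ((4 / (2 * pi)) ^ DIM('a) * exp (2 * K * s)) *
      weighted_norm p \<omega> (4 * K * s) (Rihaczek f) *
      weighted_norm (conj_exponent p) \<omega> (4 * K * s) (Rihaczek f)"
proof -
  have [measurable]: "f \<in> borel_measurable borel" using f by auto
  obtain x \<xi> where z: "z = (x, \<xi>)" by (cases z)
  \<comment> \<open>Squaring doubles \<open>s\<close>, and splitting the weight of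
    \<open>(x, \<xi>)\<close> costs a factor \<open>K\<close>; each component then carries
    \<open>2 * K * s\<close>, and the Rihaczek norms carry twice that.\<close>
  define a where "a = 2 * K * s"
  have a: "a \<ge> 0" using s weight_K[OF w] by (simp add: a_def)
  let ?W = "cmod (Wig f z)" and ?N = "\<lambda>q h. weighted_norm q \<omega> a h"
  let ?p' = "conj_exponent p" and ?f = "fourier f"
  have "ennreal (exp (a * \<omega> (norm x))) * ennreal ?W
     \<le> ennreal (exp (a * \<omega> (norm x))) * (ennreal (2 ^ DIM('a)) *
        (\<integral>\<^sup>+ u. ennreal (cmod (f u) * cmod (f (2 *\<^sub>R x - u))) \<partial>lborel))"
    unfolding z by (intro mult_left_mono Wig_le) auto
  also have "\<dots> \<le> ennreal (2 ^ DIM('a)) * (?N p f * ?N ?p' f)"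
    unfolding mult.left_commute[of _ "ennreal (2 ^ DIM('a))"]
    by (intro mult_left_mono weighted_midpoint_le[OF w p a]) auto
  finally have X: "ennreal (exp (a * \<omega> (norm x))) * ennreal ?W \<le> ennreal (2 ^ DIM('a)) * (?N p f * ?N ?p' f)" .
  have "ennreal (exp (a * \<omega> (norm \<xi>))) * (ennreal ?W * ennreal ((2 * pi) ^ DIM('a)))
     \<le> ennreal (exp (a * \<omega> (norm \<xi>))) * (ennreal (2 ^ DIM('a)) *
        (\<integral>\<^sup>+ u. ennreal (cmod (?f u) * cmod (?f (2 *\<^sub>R \<xi> - u))) \<partial>lborel))"
    unfolding z by (intro mult_left_mono Wig_le_fourier[OF f]) auto
  also have "\<dots> \<le> ennreal (2 ^ DIM('a)) * (?N p ?f * ?N ?p' ?f)"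
    unfolding mult.left_commute[of _ "ennreal (2 ^ DIM('a))"]
    by (intro mult_left_mono weighted_midpoint_le[OF w p a]) auto
  finally have Y: "ennreal (exp (a * \<omega> (norm \<xi>))) * (ennreal ?W * ennreal ((2 * pi) ^ DIM('a)))
     \<le> ennreal (2 ^ DIM('a)) * (?N p ?f * ?N ?p' ?f)" .
  have "2 * s * \<omega> (norm z) \<le> 2 * s * (K * (1 + \<omega> (norm x) + \<omega> (norm \<xi>)))"
    unfolding z using s norm_Pair_le[of x \<xi>] by (intro mult_left_mono weight_subadditive[OF w]) auto
  then have "exp (2 * s * \<omega> (norm z)) \<le> exp a * (exp (a * \<omega> (norm x)) * exp (a * \<omega> (norm \<xi>)))"
    by (simp add: exp_add[symmetric] a_def algebra_simps)
  then have "exp (2 * s * \<omega> (norm z)) * ?W\<^sup>2 \<le> exp a * (exp (a * \<omega> (norm x)) * exp (a * \<omega> (norm \<xi>))) * ?W\<^sup>2"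
    by (rule mult_right_mono) auto
  then have "(exp (s * \<omega> (norm z)) * ?W)\<^sup>2
      \<le> exp a * ((exp (a * \<omega> (norm x)) * ?W) * (exp (a * \<omega> (norm \<xi>)) * ?W))"
    by (simp add: power_mult_distrib exp_double[symmetric] power2_eq_square[of ?W] mult_ac)
  then have "(ennreal (exp (s * \<omega> (norm z)) * ?W))\<^sup>2
      \<le> ennreal (exp a) * ((ennreal (exp (a * \<omega> (norm x))) * ennreal ?W) *
          (ennreal (exp (a * \<omega> (norm \<xi>))) * ennreal ?W))"
    by (simp add: ennreal_mult[symmetric] ennreal_power)
  then have "(ennreal (exp (s * \<omega> (norm z)) * ?W))\<^sup>2 * ennreal ((2 * pi) ^ DIM('a))
      \<le> ennreal (exp a) * ((ennreal (exp (a * \<omega> (norm x))) * ennreal ?W) *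
          (ennreal (exp (a * \<omega> (norm \<xi>))) * ennreal ?W)) * ennreal ((2 * pi) ^ DIM('a))"
    by (rule mult_right_mono) auto
  also have "\<dots> = ennreal (exp a) * ((ennreal (exp (a * \<omega> (norm x))) * ennreal ?W) *
          (ennreal (exp (a * \<omega> (norm \<xi>))) * (ennreal ?W * ennreal ((2 * pi) ^ DIM('a)))))"
    by (simp only: mult.assoc)
  also have "\<dots> \<le> ennreal (exp a) * ((ennreal (2 ^ DIM('a)) * (?N p f * ?N ?p' f)) *
          (ennreal (2 ^ DIM('a)) * (?N p ?f * ?N ?p' ?f)))"
    by (intro mult_left_mono mult_mono X Y) auto
  \<comment> \<open>Norms with the same exponent are brought together, so that each pair is bounded
    by a norm of the Rihaczek form. The two factors \<open>2 ^ DIM('a)\<close> combine to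
    \<open>4 ^ DIM('a)\<close>.\<close>
  also have "\<dots> = ennreal (exp a * 4 ^ DIM('a)) * ((?N p f * ?N p ?f) * (?N ?p' f * ?N ?p' ?f))"
  proof -
    have "ennreal (exp a * 4 ^ DIM('a)) = ennreal (exp a) * (ennreal (2 ^ DIM('a)) * ennreal (2 ^ DIM('a)))"
      by (simp add: ennreal_mult[symmetric] power_mult_distrib[symmetric])
    then show ?thesis by (simp only: mult_ac)
  qed
  also have "\<dots> \<le> ennreal (exp a * 4 ^ DIM('a)) *
      (weighted_norm p \<omega> (2 * a) (Rihaczek f) * weighted_norm ?p' \<omega> (2 * a) (Rihaczek f))"
    by (intro mult_left_mono mult_mono weighted_norm_Rihaczek_ge[OF w] p conj_exponent_ge_1 a) auto
  finally have "(ennreal (exp (s * \<omega> (norm z)) * ?W))\<^sup>2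
     \<le> ennreal (1 / (2 * pi) ^ DIM('a)) * (ennreal (exp a * 4 ^ DIM('a)) *
      (weighted_norm p \<omega> (2 * a) (Rihaczek f) * weighted_norm ?p' \<omega> (2 * a) (Rihaczek f)))"
    by (rule ennreal_le_of_mult_le) simp
  also have "\<dots> = ennreal (1 / (2 * pi) ^ DIM('a) * (exp a * 4 ^ DIM('a))) *
      weighted_norm p \<omega> (2 * a) (Rihaczek f) * weighted_norm ?p' \<omega> (2 * a) (Rihaczek f)"
    by (subst ennreal_mult) (auto simp: mult.assoc)
  also have "1 / (2 * pi) ^ DIM('a) * (exp a * 4 ^ DIM('a)) = (4 / (2 * pi)) ^ DIM('a) * exp (2 * K * s)"
  proof -
    have "(4::real) ^ DIM('a) = 2 ^ DIM('a) * 2 ^ DIM('a)" by (simp flip: power_mult_distrib)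
    then show ?thesis by (simp add: a_def power_divide)
  qed
  also have "2 * a = 4 * K * s" by (simp add: a_def)
  finally show ?thesis .
qed

lemma weighted_norm_top_Wig_le:
  fixes f :: "'a::euclidean_space \<Rightarrow> complex"
  assumes w: "weight_function \<omega> K b" and p: "1 \<le> p" and s: "0 \<le> s" and f: "f \<in> S_space \<omega>"
  shows "(weighted_norm top \<omega> s (Wig f))\<^sup>2
    \<le> ennreal ((4 / (2 * pi)) ^ DIM('a) * exp ((K + 2 * K\<^sup>2) * s)) *
      weighted_norm p \<omega> (4 * K\<^sup>2 * s) (Rihaczek f) *
      weighted_norm (conj_exponent p) \<omega> (4 * K\<^sup>2 * s) (Rihaczek f)" (is "_ \<le> ?R")
proof -
  note [measurable] = exp_weight_measurable[OF w]
  obtain B where f': "integrable lborel f" "continuous_on UNIV f" "\<And>x. cmod (f x) \<le> B"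
    using S_spaceD[OF w f] by blast
  have [measurable]: "f \<in> borel_measurable borel" using f' by auto
  \<comment> \<open>With \<open>K \<le> K\<^sup>2\<close>, the constants \<open>2 * K\<close> and
    \<open>4 * K\<close> of \<open>weighted_Wig_le\<close> are relaxed to
    \<open>K + 2 * K\<^sup>2\<close> and \<open>4 * K\<^sup>2\<close>, the form in which they enter
    \<open>D10\<close> and \<open>D6\<close>.\<close>
  have K: "1 \<le> K" "K \<le> K\<^sup>2" using weight_K[OF w] by (auto simp: power2_eq_square)
  have c: "(4 / (2 * pi)) ^ DIM('a) * exp (2 * K * s) \<le> (4 / (2 * pi)) ^ DIM('a) * exp ((K + 2 * K\<^sup>2) * s)"
    using K s by (intro mult_left_mono) (auto intro!: mult_right_mono)
  have l: "4 * K * s \<le> 4 * K\<^sup>2 * s" using K s by (intro mult_right_mono) auto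
  have "(ennreal (exp (s * \<omega> (norm z)) * cmod (Wig f z)))\<^sup>2 \<le> ?R" for z
    by (rule order_trans[OF weighted_Wig_le[OF w p s f']])
       (intro mult_mono ennreal_leI c weighted_norm_mono[OF w] p conj_exponent_ge_1 l; simp)
  then have R: "ennreal ((norm (exp (s * \<omega> (norm z)) *\<^sub>R Wig f z))\<^sup>2) \<le> ?R" for z
    by (simp add: ennreal_power)
  have "(L_norm (2 * top) (\<lambda>z. exp (s * \<omega> (norm z)) *\<^sub>R Wig f z))\<^sup>2
     \<le> L_norm top (\<lambda>z. (norm (exp (s * \<omega> (norm z)) *\<^sub>R Wig f z))\<^sup>2)"
    by (rule L_norm_double_exponent) auto
  also have "\<dots> \<le> ?R"
    unfolding L_norm_top by (rule esssup_I) (use R in auto)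
  finally show ?thesis by (simp add: weighted_norm_def ennreal_mult_top)
qed

section \<open>Positivity of norms, excluding products 0 * \<infinity>\<close>

lemma L_norm_mono_ennreal:
  fixes F :: "'a::euclidean_space \<Rightarrow> 'b::real_normed_vector"
    and G :: "'a \<Rightarrow> 'c::real_normed_vector"
  assumes q: "1 \<le> q" and [measurable]: "(\<lambda>x. norm (F x)) \<in> borel_measurable borel"
      "(\<lambda>x. norm (G x)) \<in> borel_measurable borel"
    and G: "L_norm q G \<noteq> 0" and le: "\<And>x. ennreal (norm (F x)) \<le> ennreal (norm (G x)) * M"
  shows "L_norm q F \<le> L_norm q G * M"
proof (cases M)
  case (real m)
  have "norm (F x) \<le> m * norm (G x)" for x
    using le[of x] real by (simp add: ennreal_mult[symmetric] mult.commute)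
  then show ?thesis
    using L_norm_mono[OF q, of F G m] real by (simp add: mult.commute)
next
  case top
  \<comment> \<open>With \<open>M\<close> infinite, the nonzero norm of \<open>G\<close> makes the
    right side \<infinity> instead of 0 * \<infinity> = 0.\<close>
  then show ?thesis using G by (simp add: ennreal_mult_top)
qed

lemma L_norm_exp_pos:
  assumes q: "1 \<le> q" and [measurable]: "h \<in> borel_measurable borel"
  shows "L_norm q (\<lambda>z :: 'a::euclidean_space. exp (h z :: real)) \<noteq> 0"
proof
  assume "L_norm q (\<lambda>z. exp (h z)) = 0"
  then have "AE z in (lborel :: 'a measure). exp (h z) = 0"
    by (intro L_norm_eq_0_AE[OF q]) auto
  then have "AE z in (lborel :: 'a measure). cmod 1 \<le> 0" by simp
  then show False
    using continuous_AE_le[of "\<lambda>_::'a. 1" 0] by simp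
qed

lemma weighted_norm_top_pos:
  fixes h :: "'a::euclidean_space \<Rightarrow> complex"
  assumes w: "weight_function \<omega> K b" and c: "0 \<le> l" and h: "continuous_on UNIV h" "h \<noteq> (\<lambda>x. 0)"
  shows "weighted_norm top \<omega> 0 h \<noteq> 0" and "weighted_norm top \<omega> 0 h \<le> weighted_norm top \<omega> l h"
proof -
  have [measurable]: "h \<in> borel_measurable borel" using h by (intro borel_measurable_continuous_onI)
  show "weighted_norm top \<omega> 0 h \<noteq> 0"
  proof
    assume "weighted_norm top \<omega> 0 h = 0"
    then have "AE x in lborel. cmod (h x) \<le> 0"
      using AE_le_weighted_norm_top[of 0 \<omega> h] by simp
    then have "cmod (h x) \<le> 0" for x by (rule continuous_AE_le[OF h(1)])
    then show False using h(2) by auto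
  qed
  show "weighted_norm top \<omega> 0 h \<le> weighted_norm top \<omega> l h"
    by (intro weighted_norm_mono[OF w] c) auto
qed

section \<open>Weighted bounds of the Rihaczek form by the short-time Fourier transform\<close>

lemma L_norm_2_eq:
  fixes g :: "'a::euclidean_space \<Rightarrow> complex"
  shows "(L_norm 2 g) ^ 4 = (\<integral>\<^sup>+ x. ennreal ((cmod (g x))\<^sup>2) \<partial>lborel)\<^sup>2"
proof -
  have "L_norm 2 g = root_ennreal 2 (\<integral>\<^sup>+ x. ennreal ((cmod (g x))\<^sup>2) \<partial>lborel)"
    by (subst L_norm_finite) (auto simp: powr_numeral)
  moreover have "(root_ennreal 2 I) ^ 4 = I\<^sup>2" for I
  proof (cases I)
    case (real r)
    then have "(sqrt r) ^ 4 = r\<^sup>2"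
      by (simp add: power4_eq_xxxx power2_eq_square)
    then show ?thesis using real by (simp add: root_ennreal_def powr_half_sqrt ennreal_power)
  qed (simp add: root_ennreal_def)
  ultimately show ?thesis by simp
qed

text \<open>Finiteness comes from \<open>(cmod (g x))\<^sup>2 \<le> C * cmod (g x)\<close>,
  positivity from continuity and a nonzero value of \<open>g\<close>; afterwards one can divide by
  \<open>G\<close>.\<close>

lemma L2_pos_finite:
  fixes g :: "'a::euclidean_space \<Rightarrow> complex"
  assumes g: "integrable lborel g" "continuous_on UNIV g" "\<And>x. cmod (g x) \<le> C" "g \<noteq> (\<lambda>x. 0)"
  obtains G where "G > 0" "(\<integral>\<^sup>+ x. ennreal ((cmod (g x))\<^sup>2) \<partial>lborel) = ennreal G"
proof -
  have [measurable]: "g \<in> borel_measurable borel" using g by auto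
  have C: "0 \<le> C" using g(3)[of 0] norm_ge_zero[of "g 0"] by linarith
  have int: "integrable lborel (\<lambda>x. (cmod (g x))\<^sup>2)"
    by (rule Bochner_Integration.integrable_bound[of _ "\<lambda>y. complex_of_real C * g y"])
       (use g C in \<open>auto simp: norm_mult power2_eq_square intro!: mult_right_mono\<close>)
  let ?I = "\<integral>\<^sup>+ x. ennreal ((cmod (g x))\<^sup>2) \<partial>lborel"
  have "?I \<noteq> 0"
  proof
    assume "?I = 0"
    then have "AE x in lborel. cmod (g x) \<le> 0" by (subst (asm) nn_integral_0_iff_AE) auto
    then have "cmod (g x) \<le> 0" for x by (rule continuous_AE_le[OF g(2)])
    then show False using g(4) by auto
  qed
  moreover have "?I = ennreal (LINT x|lborel. (cmod (g x))\<^sup>2)"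
    using int by (intro nn_integral_eq_integral) auto
  ultimately show ?thesis using that[of "LINT x|lborel. (cmod (g x))\<^sup>2"]
    by (metis ennreal_eq_0_iff not_le)
qed

text \<open>Both STFT bounds have the same shape; \<open>\<pi>\<close> stands for one of the two projections of the
  time-frequency plane, and \<open>H\<close> for the window or its Fourier transform.\<close>

lemma weighted_STFT_bound:
  fixes H :: "'a::euclidean_space \<Rightarrow> complex" and V :: "'a \<times> 'a \<Rightarrow> complex" and \<pi> :: "'a \<times> 'a \<Rightarrow> 'a"
  assumes w: "weight_function \<omega> K b" and a: "0 \<le> a"
    and [measurable]: "H \<in> borel_measurable borel" "V \<in> borel_measurable borel" "\<pi> \<in> borel_measurable borel"
    and \<pi>: "\<And>z. norm (\<pi> z) \<le> norm z"
    and AE: "AE z in lborel. ennreal (exp (K * a * \<omega> (norm (y - \<pi> z))) * cmod (H (y - \<pi> z))) \<le> P"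
  shows "ennreal (exp (a * \<omega> (norm y))) * (\<integral>\<^sup>+ z. ennreal (cmod (V z) * cmod (H (y - \<pi> z))) \<partial>lborel)
    \<le> ennreal (exp (K * a)) * P * (\<integral>\<^sup>+ z. ennreal (exp (K * a * \<omega> (norm z)) * cmod (V z)) \<partial>lborel)"
proof -
  note [measurable] = exp_weight_measurable[OF w]
  have "ennreal (exp (a * \<omega> (norm y))) * (\<integral>\<^sup>+ z. ennreal (cmod (V z) * cmod (H (y - \<pi> z))) \<partial>lborel)
     = (\<integral>\<^sup>+ z. ennreal (exp (a * \<omega> (norm y))) * ennreal (cmod (V z) * cmod (H (y - \<pi> z))) \<partial>lborel)"
    by (subst nn_integral_cmult[symmetric]) auto
  also have "\<dots> \<le> (\<integral>\<^sup>+ z. ennreal (exp (K * a)) * P * ennreal (exp (K * a * \<omega> (norm z)) * cmod (V z)) \<partial>lborel)"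
  proof (rule nn_integral_mono_AE, use AE in eventually_elim)
    case (elim z)
    have "\<omega> (norm y) \<le> K * (1 + \<omega> (norm (\<pi> z)) + \<omega> (norm (y - \<pi> z)))"
      using norm_triangle_ineq[of "\<pi> z" "y - \<pi> z"] by (intro weight_subadditive[OF w]) auto
    \<comment> \<open>The projection does not increase the norm, so the weight of
      \<open>\<pi> z\<close> is enlarged to the weight of \<open>z\<close>, which is the same for
      both projections.\<close>
    also have "\<dots> \<le> K * (1 + \<omega> (norm z) + \<omega> (norm (y - \<pi> z)))"
      using weight_K[OF w] weight_mono[OF w _ \<pi>[of z]] by (intro mult_left_mono) auto
    finally have "a * \<omega> (norm y) \<le> a * (K * (1 + \<omega> (norm z) + \<omega> (norm (y - \<pi> z))))"
      using a by (rule mult_left_mono)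
    then have "exp (a * \<omega> (norm y))
        \<le> exp (K * a) * (exp (K * a * \<omega> (norm (y - \<pi> z))) * exp (K * a * \<omega> (norm z)))"
      by (simp add: exp_add[symmetric] algebra_simps)
    then have "exp (a * \<omega> (norm y)) * (cmod (V z) * cmod (H (y - \<pi> z)))
        \<le> exp (K * a) * (exp (K * a * \<omega> (norm (y - \<pi> z))) * exp (K * a * \<omega> (norm z)))
            * (cmod (V z) * cmod (H (y - \<pi> z)))"
      by (rule mult_right_mono) auto
    then have "ennreal (exp (a * \<omega> (norm y))) * ennreal (cmod (V z) * cmod (H (y - \<pi> z)))
        \<le> ennreal (exp (K * a)) * ennreal (exp (K * a * \<omega> (norm (y - \<pi> z))) * cmod (H (y - \<pi> z))) *
            ennreal (exp (K * a * \<omega> (norm z)) * cmod (V z))"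
      by (simp add: ennreal_mult[symmetric] mult_ac)
    also have "\<dots> \<le> ennreal (exp (K * a)) * P * ennreal (exp (K * a * \<omega> (norm z)) * cmod (V z))"
      using elim by (intro mult_right_mono mult_left_mono) auto
    finally show ?case .
  qed
  also have "\<dots> = ennreal (exp (K * a)) * P * (\<integral>\<^sup>+ z. ennreal (exp (K * a * \<omega> (norm z)) * cmod (V z)) \<partial>lborel)"
    by (subst nn_integral_cmult) auto
  finally show ?thesis .
qed

text \<open>The bound of the window by its weighted norm holds almost everywhere in one component;
  this carries it over to the time-frequency plane.\<close>

lemma AE_lborel_fst_snd:
  fixes P :: "'a::euclidean_space \<Rightarrow> bool"
  assumes [measurable]: "Measurable.pred borel P" and P: "AE x in lborel. P x"
  shows "AE z in (lborel :: ('a \<times> 'a) measure). P (y - fst z)"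
    and "AE z in (lborel :: ('a \<times> 'a) measure). P (y - snd z)"
proof -
  have "AE x in lborel. P (y + (-1) *\<^sub>R x)" by (rule AE_lborel_affine) (use P in auto)
  then have P': "AE x in lborel. P (y - x)" by simp
  have "AE z in (lborel \<Otimes>\<^sub>M lborel). P (y - fst z)"
    by (rule lborel_pair.AE_pair_measure[OF predE[OF measurable_compose[OF _ assms(1)]]]) (use P' in auto)
  then show "AE z in (lborel :: ('a \<times> 'a) measure). P (y - fst z)" unfolding lborel_prod .
  have "AE z in (lborel \<Otimes>\<^sub>M lborel). P (y - snd z)"
    by (rule lborel_pair.AE_pair_measure[OF predE[OF measurable_compose[OF _ assms(1)]]]) (use P' in auto)
  then show "AE z in (lborel :: ('a \<times> 'a) measure). P (y - snd z)" unfolding lborel_prod .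
qed

text \<open>The two inversion bounds are multiplied. The weight splits first between
  \<open>x\<close> and \<open>\<xi>\<close>, at the cost \<open>exp (K * a)\<close>, and then in
  each bound between window and transform, at the cost \<open>exp (K\<^sup>2 * a)\<close>; together
  this is \<open>exp (K * (1 + 2 * K) * a)\<close>.\<close>

lemma weighted_Rihaczek_le_STFT:
  fixes f g :: "'a::euclidean_space \<Rightarrow> complex"
  assumes w: "weight_function \<omega> K b" and a: "0 \<le> a"
    and f: "integrable lborel f" "continuous_on UNIV f" "\<And>x. cmod (f x) \<le> B"
    and g: "integrable lborel g" "continuous_on UNIV g" "\<And>x. cmod (g x) \<le> C"
    and G: "G > 0" "(\<integral>\<^sup>+ x. ennreal ((cmod (g x))\<^sup>2) \<partial>lborel) = ennreal G"
  shows "ennreal (exp (a * \<omega> (norm z)) * cmod (Rihaczek f z))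
    \<le> ennreal (exp (K * (1 + 2 * K) * a) / (G\<^sup>2 * (2 * pi) ^ (2 * DIM('a)))) *
      (weighted_norm top \<omega> (K\<^sup>2 * a) g * weighted_norm top \<omega> (K\<^sup>2 * a) (fourier g) *
       (\<integral>\<^sup>+ z. ennreal (exp (K\<^sup>2 * a * \<omega> (norm z)) * cmod (STFT g f z)) \<partial>lborel)\<^sup>2)"
proof -
  note [measurable] = exp_weight_measurable[OF w]
  have [measurable]: "f \<in> borel_measurable borel" "g \<in> borel_measurable borel" using f g by auto
  obtain x \<xi> where z: "z = (x, \<xi>)" by (cases z)
  have K: "1 \<le> K" by (rule weight_K[OF w])
  define c where "c = G * (2 * pi) ^ DIM('a)"
  have c: "c > 0" using G by (simp add: c_def)
  define J where "J = (\<integral>\<^sup>+ z. ennreal (exp (K\<^sup>2 * a * \<omega> (norm z)) * cmod (STFT g f z)) \<partial>lborel)"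
  define P where "P = weighted_norm top \<omega> (K\<^sup>2 * a) g"
  define Q where "Q = weighted_norm top \<omega> (K\<^sup>2 * a) (fourier g)"
  have KK: "K * (K * a) = K\<^sup>2 * a" by (simp add: power2_eq_square)
  have "ennreal (exp (K * a * \<omega> (norm x))) * (ennreal (cmod (f x)) * ennreal c)
     \<le> ennreal (exp (K * a * \<omega> (norm x))) * (\<integral>\<^sup>+ z. ennreal (cmod (STFT g f z) * cmod (g (x - fst z))) \<partial>lborel)"
    using STFT_inversion_bound[OF f g(2,3), of x] G
    by (intro mult_left_mono) (auto simp: c_def ennreal_mult mult.assoc)
  also have "\<dots> \<le> ennreal (exp (K * (K * a))) * P *
      (\<integral>\<^sup>+ z. ennreal (exp (K * (K * a) * \<omega> (norm z)) * cmod (STFT g f z)) \<partial>lborel)"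
    unfolding P_def
    by (intro weighted_STFT_bound[OF w] AE_lborel_fst_snd(1)[where P="\<lambda>v. ennreal (exp (K * (K * a) * \<omega> (norm v)) * cmod (g v)) \<le> weighted_norm top \<omega> (K\<^sup>2 * a) g"])
       (use a K AE_le_weighted_norm_top[of "K\<^sup>2 * a" \<omega> g] in \<open>auto simp: KK norm_fst_le\<close>)
  finally have X: "ennreal (exp (K * a * \<omega> (norm x))) * (ennreal (cmod (f x)) * ennreal c)
      \<le> ennreal (exp (K\<^sup>2 * a)) * P * J" unfolding KK J_def .
  have "ennreal (exp (K * a * \<omega> (norm \<xi>))) * (ennreal (cmod (fourier f \<xi>)) * ennreal c)
     \<le> ennreal (exp (K * a * \<omega> (norm \<xi>))) * (\<integral>\<^sup>+ z. ennreal (cmod (STFT g f z) * cmod (fourier g (\<xi> - snd z))) \<partial>lborel)"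
    using STFT_inversion_bound_fourier[OF f(1) g, of \<xi>] G
    by (intro mult_left_mono) (auto simp: c_def ennreal_mult mult.assoc)
  also have "\<dots> \<le> ennreal (exp (K * (K * a))) * Q *
      (\<integral>\<^sup>+ z. ennreal (exp (K * (K * a) * \<omega> (norm z)) * cmod (STFT g f z)) \<partial>lborel)"
    unfolding Q_def
    by (intro weighted_STFT_bound[OF w] AE_lborel_fst_snd(2)[where P="\<lambda>v. ennreal (exp (K * (K * a) * \<omega> (norm v)) * cmod (fourier g v)) \<le> weighted_norm top \<omega> (K\<^sup>2 * a) (fourier g)"])
       (use a K AE_le_weighted_norm_top[of "K\<^sup>2 * a" \<omega> "fourier g"] in \<open>auto simp: KK norm_snd_le\<close>)
  finally have Y: "ennreal (exp (K * a * \<omega> (norm \<xi>))) * (ennreal (cmod (fourier f \<xi>)) * ennreal c)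
      \<le> ennreal (exp (K\<^sup>2 * a)) * Q * J" unfolding KK J_def .
  have "a * \<omega> (norm z) \<le> a * (K * (1 + \<omega> (norm x) + \<omega> (norm \<xi>)))"
    unfolding z using a norm_Pair_le[of x \<xi>] by (intro mult_left_mono weight_subadditive[OF w]) auto
  then have "exp (a * \<omega> (norm z)) \<le> exp (K * a) * (exp (K * a * \<omega> (norm x)) * exp (K * a * \<omega> (norm \<xi>)))"
    by (simp add: exp_add[symmetric] algebra_simps)
  then have "exp (a * \<omega> (norm z)) * (cmod (f x) * cmod (fourier f \<xi>) * (c * c))
     \<le> exp (K * a) * (exp (K * a * \<omega> (norm x)) * exp (K * a * \<omega> (norm \<xi>))) *
         (cmod (f x) * cmod (fourier f \<xi>) * (c * c))"
    using c by (intro mult_right_mono) auto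
  then have "ennreal (exp (a * \<omega> (norm z)) * cmod (Rihaczek f z)) * ennreal (c * c)
     \<le> ennreal (exp (K * a)) * ((ennreal (exp (K * a * \<omega> (norm x))) * (ennreal (cmod (f x)) * ennreal c)) *
         (ennreal (exp (K * a * \<omega> (norm \<xi>))) * (ennreal (cmod (fourier f \<xi>)) * ennreal c)))"
    using c by (simp add: z Rihaczek_def norm_mult ennreal_mult[symmetric] mult_ac)
  also have "\<dots> \<le> ennreal (exp (K * a)) * ((ennreal (exp (K\<^sup>2 * a)) * P * J) * (ennreal (exp (K\<^sup>2 * a)) * Q * J))"
    by (intro mult_left_mono mult_mono X Y) auto
  also have "\<dots> = ennreal (exp (K * (1 + 2 * K) * a)) * (P * Q * J\<^sup>2)"
  proof -
    have "exp (K * (1 + 2 * K) * a) = exp (K * a) * (exp (K\<^sup>2 * a) * exp (K\<^sup>2 * a))"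
      by (simp add: exp_add[symmetric] power2_eq_square algebra_simps)
    then have "ennreal (exp (K * (1 + 2 * K) * a)) = ennreal (exp (K * a)) * (ennreal (exp (K\<^sup>2 * a)) * ennreal (exp (K\<^sup>2 * a)))"
      by (simp add: ennreal_mult)
    then show ?thesis by (simp only: power2_eq_square mult_ac)
  qed
  finally have "ennreal (exp (a * \<omega> (norm z)) * cmod (Rihaczek f z))
     \<le> ennreal (1 / (c * c)) * (ennreal (exp (K * (1 + 2 * K) * a)) * (P * Q * J\<^sup>2))"
    by (rule ennreal_le_of_mult_le) (use c in auto)
  also have "\<dots> = ennreal (1 / (c * c) * exp (K * (1 + 2 * K) * a)) * (P * Q * J\<^sup>2)"
    using c by (subst ennreal_mult) (auto simp: mult.assoc)
  also have "1 / (c * c) * exp (K * (1 + 2 * K) * a) = exp (K * (1 + 2 * K) * a) / (G\<^sup>2 * (2 * pi) ^ (2 * DIM('a)))"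
    by (simp only: c_def power2_eq_square power_add mult_2) (simp add: mult_ac)
  finally show ?thesis by (simp add: P_def Q_def J_def)
qed

text \<open>The weight \<open>exp (c * \<omega>)\<close> is split into
  \<open>exp ((c + m) * \<omega>)\<close> times \<open>exp (- m * \<omega>)\<close>, and Hoelder's
  inequality is used with \<open>2 * p\<close> and its conjugate. Squaring turns the first norm into
  one of the spectrogram with doubled weight.\<close>

lemma STFT_integral_le:
  fixes f g :: "'a::euclidean_space \<Rightarrow> complex"
  assumes w: "weight_function \<omega> K b" and p: "1 \<le> p"
    and [measurable]: "f \<in> borel_measurable borel" "g \<in> borel_measurable borel"
  shows "(\<integral>\<^sup>+ z. ennreal (exp (c * \<omega> (norm z)) * cmod (STFT g f z)) \<partial>lborel)\<^sup>2
    \<le> (L_norm (conj_exponent (2 * p)) (\<lambda>z :: 'a \<times> 'a. exp (- m * \<omega> (norm z))))\<^sup>2 *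
      weighted_norm p \<omega> (2 * (c + m)) (spectrogram g f)"
proof -
  note [measurable] = exp_weight_measurable[OF w]
  have [measurable]: "(\<lambda>z :: 'a \<times> 'a. exp (- (m * \<omega> (norm z)))) \<in> borel_measurable borel"
    using exp_weight_measurable[OF w, of "- m"] by simp
  let ?H = "\<lambda>z. exp ((c + m) * \<omega> (norm z)) *\<^sub>R STFT g f z"
  let ?E = "\<lambda>z :: 'a \<times> 'a. exp (- m * \<omega> (norm z))"
  have p2: "1 \<le> 2 * p" using p by (metis mult_2 add_increasing zero_le)
  have "(\<integral>\<^sup>+ z. ennreal (exp (c * \<omega> (norm z)) * cmod (STFT g f z)) \<partial>lborel)
      = (\<integral>\<^sup>+ z. ennreal (norm (?H z) * norm (?E z)) \<partial>lborel)"
    by (intro nn_integral_cong arg_cong[of _ _ ennreal]) (simp add: exp_add[symmetric] algebra_simps exp_minus field_simps)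
  also have "\<dots> \<le> L_norm (2 * p) ?H * L_norm (conj_exponent (2 * p)) ?E"
    by (intro Hoelder_L_norm p2) auto
  finally have "(\<integral>\<^sup>+ z. ennreal (exp (c * \<omega> (norm z)) * cmod (STFT g f z)) \<partial>lborel)\<^sup>2
     \<le> (L_norm (2 * p) ?H * L_norm (conj_exponent (2 * p)) ?E)\<^sup>2"
    by (rule power_mono) auto
  also have "\<dots> = (L_norm (conj_exponent (2 * p)) ?E)\<^sup>2 * (L_norm (2 * p) ?H)\<^sup>2"
    by (simp add: power_mult_distrib mult.commute)
  also have "\<dots> \<le> (L_norm (conj_exponent (2 * p)) ?E)\<^sup>2 * L_norm p (\<lambda>z. (norm (?H z))\<^sup>2)"
    by (intro mult_left_mono L_norm_double_exponent p) auto
  also have "(\<lambda>z. (norm (?H z))\<^sup>2) = (\<lambda>z. exp (2 * (c + m) * \<omega> (norm z)) *\<^sub>R spectrogram g f z)"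
    by (simp add: fun_eq_iff spectrogram_def power_mult_distrib exp_double[symmetric] mult.assoc)
  finally show ?thesis by (simp add: weighted_norm_def)
qed

section \<open>Passing to the infimum in \<open>D6\<close>\<close>

lemma ennreal_power2_le_imp_le:
  fixes x y :: ennreal
  assumes "x\<^sup>2 \<le> y\<^sup>2" shows "x \<le> y"
  using assms
  by (cases x; cases y) (auto simp: ennreal_power top_unique intro: power2_le_imp_le)

text \<open>Division by \<open>c\<close> reduces this to the defining property of the infimum. A
  factor \<infinity> is excluded because positive terms can have infimum 0, and then \<infinity> * 0
  = 0.\<close>

lemma ennreal_le_mult_INF:
  fixes T c :: ennreal
  assumes le: "\<And>i. i \<in> I \<Longrightarrow> T \<le> c * B i" and "I \<noteq> {}" "c \<noteq> top"
  shows "T \<le> c * (INF i\<in>I. B i)"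
proof (cases "c = 0")
  case True
  then show ?thesis using assms by auto
next
  case False
  have "T / c \<le> B i" if "i \<in> I" for i
  proof -
    have "T / c \<le> c * B i / c" using le[OF that] by (rule divide_right_mono_ennreal)
    also have "\<dots> = B i" using False assms(3) by (simp add: mult.commute[of c] mult_divide_eq_ennreal)
    finally show ?thesis .
  qed
  then have "T / c \<le> (INF i\<in>I. B i)" by (rule INF_greatest)
  then have "c * (T / c) \<le> c * (INF i\<in>I. B i)" by (rule mult_left_mono) simp
  moreover have "c * (T / c) = T"
    using False assms(3) by (cases T; cases c) (auto simp: divide_ennreal ennreal_mult[symmetric] ennreal_mult_top ennreal_top_divide)
  ultimately show ?thesis by simp
qed

lemma conj_exponent_two: "conj_exponent 2 = 2"
  using conj_exponent_real[of 2] by simp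

text \<open>The expression under the infimum in \<open>D6\<close> for a single pair of
  parameters.\<close>

definition D6_term ::
  "(real \<Rightarrow> real) \<Rightarrow> real \<Rightarrow> ennreal \<Rightarrow> ('a::euclidean_space \<Rightarrow> complex) \<Rightarrow> real \<Rightarrow> real \<Rightarrow> real \<Rightarrow> ennreal"
where
  "D6_term \<omega> K p g s \<mu>1 \<mu>2 =
     ennreal (exp (K * (1 + 2 * K) * (4 * K\<^sup>2 * s + \<mu>1))) *
     weighted_norm \<infinity> \<omega> (K\<^sup>2 * (4 * K\<^sup>2 * s + \<mu>1)) g *
     weighted_norm \<infinity> \<omega> (K\<^sup>2 * (4 * K\<^sup>2 * s + \<mu>1)) (fourier g) *
     L_norm 2 (\<lambda>z :: 'a \<times> 'a. exp (- \<mu>1 * \<omega> (norm z))) *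
     (L_norm (conj_exponent (2 * p)) (\<lambda>z :: 'a \<times> 'a. exp (- \<mu>2 * \<omega> (norm z))))\<^sup>2"

text \<open>The Wigner bound at exponent 2, its own conjugate, contains the same Rihaczek norm
  twice, so square roots can be taken. That L^2 norm is reduced to a uniform bound by splitting off
  \<open>exp (- \<mu>1 * \<omega>)\<close>, and the uniform bound leads to the spectrogram.\<close>

lemma weighted_Wig_le_spectrogram:
  fixes f g :: "'a::euclidean_space \<Rightarrow> complex"
  assumes w: "weight_function \<omega> K b" and p: "1 \<le> p" and s: "0 \<le> s" and m: "0 \<le> \<mu>1"
    and f: "f \<in> S_space \<omega>" and g: "g \<in> S_space \<omega>"
    and G: "G > 0" "(\<integral>\<^sup>+ x. ennreal ((cmod (g x))\<^sup>2) \<partial>lborel) = ennreal G"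
  shows "weighted_norm top \<omega> s (Wig f)
    \<le> ennreal (2 ^ DIM('a) * exp (K / 2 * (1 + 2 * K) * s) / ((2 * pi) powr (5 / 2 * DIM('a)) * G\<^sup>2)) *
      D6_term \<omega> K p g s \<mu>1 \<mu>2 *
      weighted_norm p \<omega> (8 * K^4 * s + 2 * (K\<^sup>2 * \<mu>1 + \<mu>2)) (spectrogram g f)"
proof -
  note [measurable] = weight_measurable[OF w]
  obtain B where f': "integrable lborel f" "continuous_on UNIV f" "\<And>x. cmod (f x) \<le> B"
    using S_spaceD[OF w f] by blast
  obtain C where g': "integrable lborel g" "continuous_on UNIV g" "\<And>x. cmod (g x) \<le> C"
    using S_spaceD[OF w g] by blast
  have [measurable]: "f \<in> borel_measurable borel" "g \<in> borel_measurable borel" using f' g' by auto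
  \<comment> \<open>\<open>r\<close> is the weight required by the Wigner bound;
    \<open>\<mu>1\<close> is added in \<open>a\<close> to pay for the passage from the L^2 norm to a
    uniform bound.\<close>
  define r where "r = 4 * K\<^sup>2 * s"
  define a where "a = r + \<mu>1"
  have a: "0 \<le> a" using s m by (simp add: a_def r_def)
  let ?E1 = "L_norm 2 (\<lambda>z :: 'a \<times> 'a. exp (- \<mu>1 * \<omega> (norm z)))"
  let ?E2 = "L_norm (conj_exponent (2 * p)) (\<lambda>z :: 'a \<times> 'a. exp (- \<mu>2 * \<omega> (norm z)))"
  let ?S = "weighted_norm p \<omega> (8 * K^4 * s + 2 * (K\<^sup>2 * \<mu>1 + \<mu>2)) (spectrogram g f)"
  let ?P = "weighted_norm top \<omega> (K\<^sup>2 * a) g" and ?Q = "weighted_norm top \<omega> (K\<^sup>2 * a) (fourier g)"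
  define e where "e = exp (K * (1 + 2 * K) * a)"
  define d where "d = 1 / (G\<^sup>2 * (2 * pi) ^ (2 * DIM('a)))"
  define M where "M = ennreal (d * e) * (?P * ?Q * (?E2\<^sup>2 * ?S))"
  have d: "d \<ge> 0" and e: "e \<ge> 0" by (auto simp: d_def e_def)
  \<comment> \<open>The doubling in \<open>STFT_integral_le\<close> gives the weight
    \<open>2 * (K\<^sup>2 * a + \<mu>2)\<close>; inserting \<open>a\<close> gives the one in the
    claim.\<close>
  have Ka: "2 * (K\<^sup>2 * a + \<mu>2) = 8 * K^4 * s + 2 * (K\<^sup>2 * \<mu>1 + \<mu>2)"
    by (simp add: a_def r_def algebra_simps power2_eq_square power4_eq_xxxx)
  have J: "(\<integral>\<^sup>+ z. ennreal (exp (K\<^sup>2 * a * \<omega> (norm z)) * cmod (STFT g f z)) \<partial>lborel)\<^sup>2 \<le> ?E2\<^sup>2 * ?S"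
    using STFT_integral_le[OF w p, of f g "K\<^sup>2 * a" \<mu>2] unfolding Ka by simp
  have pt: "ennreal (exp (a * \<omega> (norm z)) * cmod (Rihaczek f z)) \<le> M" for z
  proof -
    have "ennreal (exp (a * \<omega> (norm z)) * cmod (Rihaczek f z)) \<le> ennreal (d * e) *
       (?P * ?Q * (\<integral>\<^sup>+ z. ennreal (exp (K\<^sup>2 * a * \<omega> (norm z)) * cmod (STFT g f z)) \<partial>lborel)\<^sup>2)"
      using weighted_Rihaczek_le_STFT[OF w a f' g' G, of z] by (simp add: d_def e_def)
    also have "\<dots> \<le> M" unfolding M_def by (intro mult_left_mono J zero_le)
    finally show ?thesis .
  qed
  have "L_norm 2 (\<lambda>z. exp (r * \<omega> (norm z)) *\<^sub>R Rihaczek f z) \<le> ?E1 * M"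
  proof (rule L_norm_mono_ennreal)
    show "?E1 \<noteq> 0" by (intro L_norm_exp_pos) auto
    fix z :: "'a \<times> 'a"
    have "exp (r * \<omega> (norm z)) * cmod (Rihaczek f z)
       = exp (- \<mu>1 * \<omega> (norm z)) * (exp (a * \<omega> (norm z)) * cmod (Rihaczek f z))"
      by (simp add: a_def mult.assoc[symmetric] exp_add[symmetric] algebra_simps)
    then have "ennreal (norm (exp (r * \<omega> (norm z)) *\<^sub>R Rihaczek f z))
       = ennreal (norm (exp (- \<mu>1 * \<omega> (norm z)))) * ennreal (exp (a * \<omega> (norm z)) * cmod (Rihaczek f z))"
      by (simp add: ennreal_mult[symmetric])
    also have "\<dots> \<le> ennreal (norm (exp (- \<mu>1 * \<omega> (norm z)))) * M"
      by (intro mult_left_mono pt) auto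
    finally show "ennreal (norm (exp (r * \<omega> (norm z)) *\<^sub>R Rihaczek f z))
       \<le> ennreal (norm (exp (- \<mu>1 * \<omega> (norm z)))) * M" .
  next
    show "(\<lambda>z :: 'a \<times> 'a. norm (exp (- \<mu>1 * \<omega> (norm z)))) \<in> borel_measurable borel"
      by measurable
  qed auto
  then have R: "weighted_norm 2 \<omega> r (Rihaczek f) \<le> ?E1 * M" by (simp add: weighted_norm_def)
  \<comment> \<open>The square root of the constant in
    \<open>weighted_norm_top_Wig_le\<close>.\<close>
  define A where "A = 2 ^ DIM('a) * (2 * pi) powr (- DIM('a) / 2) * exp (K / 2 * (1 + 2 * K) * s)"
  have A0: "A \<ge> 0" by (simp add: A_def)
  have A2: "A\<^sup>2 = (4 / (2 * pi)) ^ DIM('a) * exp ((K + 2 * K\<^sup>2) * s)"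
  proof -
    have "((2 * pi) powr (- DIM('a) / 2))\<^sup>2 = (2 * pi) powr (- real DIM('a))"
      by (simp add: power2_eq_square powr_add[symmetric])
    also have "\<dots> = 1 / (2 * pi) ^ DIM('a)" by (simp only: powr_minus powr_realpow inverse_eq_divide) (simp add: powr_realpow)
    finally have 1: "((2 * pi) powr (- DIM('a) / 2))\<^sup>2 = 1 / (2 * pi) ^ DIM('a)" .
    have 2: "(exp (K / 2 * (1 + 2 * K) * s))\<^sup>2 = exp ((K + 2 * K\<^sup>2) * s)"
      by (simp add: power2_eq_square exp_add[symmetric] algebra_simps)
    have 3: "(2 ^ DIM('a))\<^sup>2 = (4::real) ^ DIM('a)"
      by (simp add: power2_eq_square flip: power_mult_distrib)
    show ?thesis unfolding A_def power_mult_distrib[of "_ * _"] power_mult_distrib[of "2 ^ _"] 1 2 3 power_divide[of 4] by simp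
  qed
  have "(weighted_norm top \<omega> s (Wig f))\<^sup>2
     \<le> ennreal (A\<^sup>2) * weighted_norm 2 \<omega> r (Rihaczek f) * weighted_norm 2 \<omega> r (Rihaczek f)"
    unfolding A2 r_def
    using weighted_norm_top_Wig_le[OF w _ s f, of 2] by (simp add: conj_exponent_two)
  also have "\<dots> = (ennreal A * weighted_norm 2 \<omega> r (Rihaczek f))\<^sup>2"
    using A0 by (simp add: power_mult_distrib ennreal_power power2_eq_square[of "weighted_norm _ _ _ _"] mult.assoc)
  finally have "weighted_norm top \<omega> s (Wig f) \<le> ennreal A * weighted_norm 2 \<omega> r (Rihaczek f)"
    by (rule ennreal_power2_le_imp_le)
  also have "\<dots> \<le> ennreal A * (?E1 * M)" by (intro mult_left_mono R) auto
  also have "\<dots> = ennreal (A * d) * (ennreal e * ?P * ?Q * ?E1 * ?E2\<^sup>2) * ?S"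
    using A0 d e by (simp add: M_def ennreal_mult mult_ac)
  \<comment> \<open>The exponent 5/2 of 2 pi per dimension consists of 1/2 from \<open>A\<close> and
    2 from \<open>d\<close>.\<close>
  also have "A * d = 2 ^ DIM('a) * exp (K / 2 * (1 + 2 * K) * s) / ((2 * pi) powr (5 / 2 * DIM('a)) * G\<^sup>2)"
  proof -
    have "(2 * pi) powr (5 / 2 * DIM('a)) * (2 * pi) powr (- DIM('a) / 2) = (2 * pi) powr (real (2 * DIM('a)))"
      by (simp add: powr_add[symmetric])
    also have "\<dots> = (2 * pi) ^ (2 * DIM('a))" by (rule powr_realpow) simp
    finally have *: "(2 * pi) ^ (2 * DIM('a)) = (2 * pi) powr (5 / 2 * DIM('a)) * (2 * pi) powr (- DIM('a) / 2)" ..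
    show ?thesis unfolding A_def d_def * using G by (simp add: field_simps)
  qed
  finally show ?thesis by (simp add: D6_term_def e_def a_def r_def)
qed

text \<open>A positive lower bound common to all admissible pairs keeps the infimum in
  \<open>D6\<close> away from 0. It serves the case of an infinite spectrogram norm, where an
  infimum 0 would make the product 0. By monotonicity the weights on the window are lowered to 0 and
  the parameters of the decaying exponentials raised to \<open>\<mu>\<close>.\<close>

lemma D6_term_lower_bound:
  fixes g :: "'a::euclidean_space \<Rightarrow> complex"
  assumes w: "weight_function \<omega> K b" and g: "g \<in> S_space \<omega>" "g \<noteq> (\<lambda>x. 0)"
  obtains \<delta> where "\<delta> > 0"
    "\<And>s \<mu>1 \<mu>2. 0 \<le> s \<Longrightarrow> 0 \<le> \<mu>1 \<Longrightarrow> \<mu>1 \<le> \<mu> \<Longrightarrow> \<mu>2 \<le> \<mu> \<Longrightarrow> \<delta> \<le> D6_term \<omega> K p g s \<mu>1 \<mu>2"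
proof -
  note [measurable] = weight_measurable[OF w]
  have gi: "integrable lborel g" and gc: "continuous_on UNIV g" and Fc: "continuous_on UNIV (fourier g)"
    using S_spaceD[OF w g(1)] by blast+
  obtain C where C: "\<And>x. cmod (g x) \<le> C" using S_spaceD[OF w g(1)] by blast
  obtain G where G: "G > 0" "(\<integral>\<^sup>+ x. ennreal ((cmod (g x))\<^sup>2) \<partial>lborel) = ennreal G"
    using L2_pos_finite[OF gi gc C g(2)] .
  \<comment> \<open>A vanishing Fourier transform would contradict \<open>Plancherel_le\<close> with
    \<open>G > 0\<close>.\<close>
  have Fz: "fourier g \<noteq> (\<lambda>x. 0)"
  proof
    assume "fourier g = (\<lambda>x. 0)"
    then show False using Plancherel_le[OF gi gc C] G by (simp add: ennreal_mult[symmetric])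
  qed
  define E where "E q m = L_norm q (\<lambda>z :: 'a \<times> 'a. exp (- m * \<omega> (norm z)))" for q m
  have Epos: "E q m \<noteq> 0" if "1 \<le> q" for q m
    unfolding E_def using that by (intro L_norm_exp_pos) auto
  have Emono: "E q \<mu> \<le> E q m" if q: "1 \<le> q" and m: "m \<le> \<mu>" for q m
  proof -
    have "E q \<mu> \<le> ennreal 1 * E q m" unfolding E_def
    proof (intro L_norm_mono q AE_I2)
      fix z :: "'a \<times> 'a"
      have "m * \<omega> (norm z) \<le> \<mu> * \<omega> (norm z)"
        using m weight_nonneg[OF w, of "norm z"] by (intro mult_right_mono) auto
      then show "norm (exp (- \<mu> * \<omega> (norm z))) \<le> 1 * norm (exp (- m * \<omega> (norm z)))" by simp
    qed auto
    then show ?thesis by simp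
  qed
  let ?q = "conj_exponent (2 * p)"
  define \<delta> where "\<delta> = ennreal 1 * weighted_norm top \<omega> 0 g * weighted_norm top \<omega> 0 (fourier g) * E 2 \<mu> * (E ?q \<mu>)\<^sup>2"
  have "\<delta> \<noteq> 0"
    using weighted_norm_top_pos(1)[OF w order_refl gc g(2)]
      weighted_norm_top_pos(1)[OF w order_refl Fc Fz] Epos[of 2] Epos[OF conj_exponent_ge_1]
    by (simp add: \<delta>_def)
  then have "\<delta> > 0" by (simp add: zero_less_iff_neq_zero)
  moreover have "\<delta> \<le> D6_term \<omega> K p g s \<mu>1 \<mu>2"
    if "0 \<le> s" "0 \<le> \<mu>1" "\<mu>1 \<le> \<mu>" "\<mu>2 \<le> \<mu>" for s \<mu>1 \<mu>2
  proof -
    have K: "1 \<le> K" by (rule weight_K[OF w])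
    have l: "0 \<le> K\<^sup>2 * (4 * K\<^sup>2 * s + \<mu>1)" using that by simp
    have "0 \<le> K * (1 + 2 * K) * (4 * K\<^sup>2 * s + \<mu>1)" using that K by simp
    then have 1: "ennreal 1 \<le> ennreal (exp (K * (1 + 2 * K) * (4 * K\<^sup>2 * s + \<mu>1)))"
      by (intro ennreal_leI) simp
    have "\<delta> \<le> ennreal (exp (K * (1 + 2 * K) * (4 * K\<^sup>2 * s + \<mu>1))) *
     weighted_norm top \<omega> (K\<^sup>2 * (4 * K\<^sup>2 * s + \<mu>1)) g *
     weighted_norm top \<omega> (K\<^sup>2 * (4 * K\<^sup>2 * s + \<mu>1)) (fourier g) * E 2 \<mu>1 * (E ?q \<mu>2)\<^sup>2"
      unfolding \<delta>_def
      by (intro mult_mono power_mono 1 weighted_norm_top_pos(2)[OF w l gc g(2)]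
          weighted_norm_top_pos(2)[OF w l Fc Fz] Emono that conj_exponent_ge_1) auto
    then show ?thesis by (simp add: D6_term_def E_def)
  qed
  ultimately show ?thesis using that by blast
qed

lemma weighted_Wig_le_D6:
  fixes f g :: "'a::euclidean_space \<Rightarrow> complex"
  assumes w: "weight_function \<omega> K b" and p: "1 \<le> p" and s: "0 \<le> s"
    and f: "f \<in> S_space \<omega>" and g: "g \<in> S_space \<omega>" "g \<noteq> (\<lambda>x. 0)"
    and \<mu>: "\<mu> > 2 * DIM('a) / b * (K\<^sup>2 + 2 / enn2real (conj_exponent (2 * p)))"
  shows "weighted_norm top \<omega> s (Wig f)
    \<le> D6 \<omega> K b p g s \<mu> * weighted_norm p \<omega> (8 * K^4 * s + \<mu>) (spectrogram g f)"
proof -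
  define q where "q = enn2real (conj_exponent (2 * p))"
  define I where "I = {(\<mu>1, \<mu>2). 2 * (K\<^sup>2 * \<mu>1 + \<mu>2) = \<mu> \<and> \<mu>1 > DIM('a) / b \<and> \<mu>2 > 2 * DIM('a) / (b * q)}"
  define S where "S = weighted_norm p \<omega> (8 * K^4 * s + \<mu>) (spectrogram g f)"
  have K: "1 \<le> K" "1 \<le> K\<^sup>2" and b: "0 < b" using weight_K[OF w] weight_b[OF w] by auto
  have q0: "0 \<le> q" by (simp add: q_def)
  obtain C where g': "integrable lborel g" "continuous_on UNIV g" "\<And>x. cmod (g x) \<le> C"
    using S_spaceD[OF w g(1)] by blast
  obtain G where G: "G > 0" "(\<integral>\<^sup>+ x. ennreal ((cmod (g x))\<^sup>2) \<partial>lborel) = ennreal G"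
    using L2_pos_finite[OF g' g(2)] .
  define c where "c = 2 ^ DIM('a) * exp (K / 2 * (1 + 2 * K) * s) / ((2 * pi) powr (5 / 2 * DIM('a)) * G\<^sup>2)"
  have c: "c > 0" using G by (simp add: c_def)
  have D6: "D6 \<omega> K b p g s \<mu> = ennreal c * (INF (\<mu>1, \<mu>2)\<in>I. D6_term \<omega> K p g s \<mu>1 \<mu>2)"
  proof -
    have "ennreal (2 ^ DIM('a) * exp (K / 2 * (1 + 2 * K) * s)) /
       (ennreal ((2 * pi) powr (5 / 2 * DIM('a))) * L_norm 2 g ^ 4) = ennreal c"
      using G by (simp add: c_def L_norm_2_eq ennreal_power ennreal_mult[symmetric] divide_ennreal)
    then show ?thesis by (simp only: D6_def D6_term_def I_def q_def)
  qed
  have pos: "0 \<le> \<mu>1 \<and> \<mu>1 \<le> \<mu> \<and> \<mu>2 \<le> \<mu> \<and> 2 * (K\<^sup>2 * \<mu>1 + \<mu>2) = \<mu>" if "(\<mu>1, \<mu>2) \<in> I" for \<mu>1 \<mu>2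
  proof -
    have "0 \<le> real DIM('a) / b" "0 \<le> 2 * real DIM('a) / (b * q)" using b q0 by auto
    then have "0 \<le> \<mu>1" "0 \<le> \<mu>2" and eq: "2 * (K\<^sup>2 * \<mu>1 + \<mu>2) = \<mu>"
      using that unfolding I_def by auto
    moreover have "1 * \<mu>1 \<le> K\<^sup>2 * \<mu>1" using K \<open>0 \<le> \<mu>1\<close> by (intro mult_right_mono) auto
    ultimately show ?thesis by auto
  qed
  have "I \<noteq> {}"
  proof -
    \<comment> \<open>Half the slack in the lower bound on \<open>\<mu>\<close>. It is shared
      equally between the two parameters, the first share being divided by \<open>K\<^sup>2\<close>
      because \<open>\<mu>1\<close> enters the constraint with that factor.\<close>
    define t where "t = \<mu> / 2 - K\<^sup>2 * DIM('a) / b - 2 * DIM('a) / (b * q)"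
    have t: "t > 0" using \<mu> by (simp add: t_def q_def algebra_simps)
    have "(DIM('a) / b + t / (2 * K\<^sup>2), 2 * DIM('a) / (b * q) + t / 2) \<in> I"
      using t K by (simp add: I_def) (simp add: t_def field_simps)
    then show ?thesis by blast
  qed
  have le: "weighted_norm top \<omega> s (Wig f) \<le> (ennreal c * S) * (case i of (\<mu>1, \<mu>2) \<Rightarrow> D6_term \<omega> K p g s \<mu>1 \<mu>2)"
    if "i \<in> I" for i
  proof -
    obtain \<mu>1 \<mu>2 where i: "i = (\<mu>1, \<mu>2)" by (cases i)
    have m: "0 \<le> \<mu>1" "2 * (K\<^sup>2 * \<mu>1 + \<mu>2) = \<mu>" using pos that i by auto
    show ?thesis
      using weighted_Wig_le_spectrogram[OF w p s m(1) f g(1) G, of \<mu>2] unfolding m(2)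
      by (simp add: i c_def S_def mult_ac)
  qed
  have "weighted_norm top \<omega> s (Wig f) \<le> (ennreal c * S) * (INF (\<mu>1, \<mu>2)\<in>I. D6_term \<omega> K p g s \<mu>1 \<mu>2)"
  \<comment> \<open>\<open>ennreal_le_mult_INF\<close> needs a finite factor. For an infinite
    spectrogram norm the positive lower bound makes the right side \<infinity>.\<close>
  proof (cases "S = top")
    case False
    then show ?thesis by (intro ennreal_le_mult_INF le \<open>I \<noteq> {}\<close>) (auto simp: ennreal_mult_eq_top_iff)
  next
    case True
    obtain \<delta> where "\<delta> > 0"
      "\<And>s \<mu>1 \<mu>2. 0 \<le> s \<Longrightarrow> 0 \<le> \<mu>1 \<Longrightarrow> \<mu>1 \<le> \<mu> \<Longrightarrow> \<mu>2 \<le> \<mu> \<Longrightarrow> \<delta> \<le> D6_term \<omega> K p g s \<mu>1 \<mu>2"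
      using D6_term_lower_bound[OF w g] by blast
    then have "\<delta> \<le> (INF (\<mu>1, \<mu>2)\<in>I. D6_term \<omega> K p g s \<mu>1 \<mu>2)"
      using s pos by (intro INF_greatest) auto
    then have "(INF (\<mu>1, \<mu>2)\<in>I. D6_term \<omega> K p g s \<mu>1 \<mu>2) \<noteq> 0" using \<open>\<delta> > 0\<close> by auto
    then show ?thesis using True c by (simp add: ennreal_mult_top ennreal_top_mult)
  qed
  then show ?thesis by (simp add: D6 S_def mult_ac)
qed

section \<open>Combination with the weighted convolution bound\<close>

theorem corollary3p10:
  fixes \<omega> :: "real \<Rightarrow> real" and K b :: real and p :: ennreal
  assumes "weight_function \<omega> K b" and "1 \<le> p"
  shows
    "(\<forall>\<sigma> :: 'a::euclidean_space \<times> 'a \<Rightarrow> complex.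
        \<sigma> \<in> borel_measurable lborel \<and> functional_of \<sigma> \<in> S_dual \<omega> \<and>
        (\<forall>\<nu>\<ge>0. weighted_norm (conj_exponent p) \<omega> \<nu> \<sigma> < \<infinity>) \<longrightarrow>
        (\<forall>l\<ge>0. \<forall>f \<in> S_space \<omega>.
           weighted_norm \<infinity> \<omega> l (Cohen (functional_of \<sigma>) f)
             \<le> D9 \<omega> K p \<sigma> l * weighted_norm p \<omega> (K * l) (Wig f)))
     \<and>
     (\<forall>\<sigma> :: 'a \<times> 'a \<Rightarrow> complex.
        \<sigma> \<in> borel_measurable lborel \<and> functional_of \<sigma> \<in> S_dual \<omega> \<and>
        (\<forall>\<nu>\<ge>0. weighted_norm 1 \<omega> \<nu> \<sigma> < \<infinity>) \<longrightarrow>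
        (\<forall>l\<ge>0. \<forall>f \<in> S_space \<omega>.
           (weighted_norm \<infinity> \<omega> l (Cohen (functional_of \<sigma>) f))\<^sup>2
             \<le> D10 \<omega> K \<sigma> l * weighted_norm p \<omega> (4 * K^3 * l) (Rihaczek f)
                 * weighted_norm (conj_exponent p) \<omega> (4 * K^3 * l) (Rihaczek f)))
     \<and>
     (\<forall>(\<sigma> :: 'a \<times> 'a \<Rightarrow> complex) (g :: 'a \<Rightarrow> complex).
        \<sigma> \<in> borel_measurable lborel \<and> functional_of \<sigma> \<in> S_dual \<omega> \<and>
        (\<forall>\<nu>\<ge>0. weighted_norm 1 \<omega> \<nu> \<sigma> < \<infinity>) \<and>
        g \<in> S_space \<omega> \<and> g \<noteq> (\<lambda>x. 0) \<longrightarrow>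
        (\<forall>l\<ge>0. \<forall>\<mu>. \<mu> > 2 * DIM('a) / b * (K\<^sup>2 + 2 / enn2real (conj_exponent (2 * p))) \<longrightarrow>
           (\<forall>f \<in> S_space \<omega>.
              weighted_norm \<infinity> \<omega> l (Cohen (functional_of \<sigma>) f)
                \<le> D11 \<omega> K b p g \<sigma> l \<mu> * weighted_norm p \<omega> (8 * K^5 * l + \<mu>) (spectrogram g f))))"
proof -
  note w = assms(1) and p = assms(2)
  have K: "1 \<le> K" by (rule weight_K[OF w])
  have meas: "Wig f \<in> borel_measurable borel" if "f \<in> S_space \<omega>" for f :: "'a \<Rightarrow> complex"
    using S_space_integrable[OF w that] by auto
  \<comment> \<open>The exponent is left open: \<open>q = p\<close> gives the first estimate, and
    \<open>q = \<infinity>\<close>, with conjugate 1, reduces the other two to uniform bounds of the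
    weighted Wigner transform.\<close>
  have Cohen_le: "weighted_norm top \<omega> l (Cohen (functional_of \<sigma>) f)
      \<le> ennreal (exp (K * l)) * weighted_norm (conj_exponent q) \<omega> (K * l) \<sigma> * weighted_norm q \<omega> (K * l) (Wig f)"
    if "1 \<le> q" "0 \<le> l" "\<sigma> \<in> borel_measurable lborel" "f \<in> S_space \<omega>"
    for q l and \<sigma> :: "'a \<times> 'a \<Rightarrow> complex" and f :: "'a \<Rightarrow> complex"
    using weighted_norm_convolution_le[OF w that(1,2) _ meas[OF that(4)], of \<sigma>] that(3)
    by (simp add: Cohen_def)
  show ?thesis
  proof (intro conjI allI impI ballI)
    fix \<sigma> :: "'a \<times> 'a \<Rightarrow> complex" and l :: real and f :: "'a \<Rightarrow> complex"
    assume "\<sigma> \<in> borel_measurable lborel \<and> functional_of \<sigma> \<in> S_dual \<omega> \<and>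
        (\<forall>\<nu>\<ge>0. weighted_norm (conj_exponent p) \<omega> \<nu> \<sigma> < \<infinity>)" "0 \<le> l" "f \<in> S_space \<omega>"
    then show "weighted_norm \<infinity> \<omega> l (Cohen (functional_of \<sigma>) f)
        \<le> D9 \<omega> K p \<sigma> l * weighted_norm p \<omega> (K * l) (Wig f)"
      using Cohen_le[OF p] by (simp add: D9_def)
  next
    fix \<sigma> :: "'a \<times> 'a \<Rightarrow> complex" and l :: real and f :: "'a \<Rightarrow> complex"
    assume \<sigma>: "\<sigma> \<in> borel_measurable lborel \<and> functional_of \<sigma> \<in> S_dual \<omega> \<and>
        (\<forall>\<nu>\<ge>0. weighted_norm 1 \<omega> \<nu> \<sigma> < \<infinity>)" and l: "0 \<le> l" and f: "f \<in> S_space \<omega>"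
    let ?R = "\<lambda>q. weighted_norm q \<omega> (4 * K\<^sup>2 * (K * l)) (Rihaczek f)"
    let ?n = "weighted_norm 1 \<omega> (K * l) \<sigma>" and ?c = "(4 / (2 * pi)) ^ DIM('a)"
    have "(weighted_norm top \<omega> l (Cohen (functional_of \<sigma>) f))\<^sup>2
        \<le> (ennreal (exp (K * l)) * ?n * weighted_norm top \<omega> (K * l) (Wig f))\<^sup>2"
      using Cohen_le[of top, OF _ l _ f] \<sigma> by (intro power_mono) auto
    also have "\<dots> = ennreal ((exp (K * l))\<^sup>2) * ?n\<^sup>2 * (weighted_norm top \<omega> (K * l) (Wig f))\<^sup>2"
      by (simp add: power_mult_distrib ennreal_power)
    also have "\<dots> \<le> ennreal ((exp (K * l))\<^sup>2) * ?n\<^sup>2 *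
        (ennreal (?c * exp ((K + 2 * K\<^sup>2) * (K * l))) * ?R p * ?R (conj_exponent p))"
      using K l by (intro mult_left_mono weighted_norm_top_Wig_le[OF w p _ f]) auto
    also have "\<dots> = ennreal ((exp (K * l))\<^sup>2 * (?c * exp ((K + 2 * K\<^sup>2) * (K * l)))) * ?n\<^sup>2 * ?R p * ?R (conj_exponent p)"
      by (simp add: ennreal_mult mult_ac)
    \<comment> \<open>The exponents add: \<open>2 * K * l\<close> from the squared convolution
      constant and \<open>(K + 2 * K\<^sup>2) * (K * l)\<close> from the Wigner bound.\<close>
    also have "(exp (K * l))\<^sup>2 * (?c * exp ((K + 2 * K\<^sup>2) * (K * l))) = ?c * exp (K * (2 + K + 2 * K\<^sup>2) * l)"
      by (simp add: exp_double[symmetric] mult.left_commute[of _ ?c] exp_add[symmetric] algebra_simps)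
    also have "4 * K\<^sup>2 * (K * l) = 4 * K^3 * l" by (simp add: power2_eq_square power3_eq_cube)
    finally show "(weighted_norm \<infinity> \<omega> l (Cohen (functional_of \<sigma>) f))\<^sup>2
        \<le> D10 \<omega> K \<sigma> l * weighted_norm p \<omega> (4 * K^3 * l) (Rihaczek f)
            * weighted_norm (conj_exponent p) \<omega> (4 * K^3 * l) (Rihaczek f)"
      by (simp add: D10_def)
  next
    fix \<sigma> :: "'a \<times> 'a \<Rightarrow> complex" and g :: "'a \<Rightarrow> complex" and l \<mu> :: real and f :: "'a \<Rightarrow> complex"
    assume \<sigma>: "\<sigma> \<in> borel_measurable lborel \<and> functional_of \<sigma> \<in> S_dual \<omega> \<and>
        (\<forall>\<nu>\<ge>0. weighted_norm 1 \<omega> \<nu> \<sigma> < \<infinity>) \<and> g \<in> S_space \<omega> \<and> g \<noteq> (\<lambda>x. 0)"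
      and l: "0 \<le> l" and \<mu>: "\<mu> > 2 * DIM('a) / b * (K\<^sup>2 + 2 / enn2real (conj_exponent (2 * p)))"
      and f: "f \<in> S_space \<omega>"
    have "weighted_norm top \<omega> l (Cohen (functional_of \<sigma>) f)
        \<le> ennreal (exp (K * l)) * weighted_norm 1 \<omega> (K * l) \<sigma> * weighted_norm top \<omega> (K * l) (Wig f)"
      using Cohen_le[of top, OF _ l _ f] \<sigma> by auto
    \<comment> \<open>The Wigner bound at \<open>s = K * l\<close>, which turns
      \<open>8 * K^4 * s\<close> into \<open>8 * K^5 * l\<close>.\<close>
    also have "\<dots> \<le> ennreal (exp (K * l)) * weighted_norm 1 \<omega> (K * l) \<sigma> *
        (D6 \<omega> K b p g (K * l) \<mu> * weighted_norm p \<omega> (8 * K^4 * (K * l) + \<mu>) (spectrogram g f))"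
      using \<sigma> K l by (intro mult_left_mono weighted_Wig_le_D6[OF w p _ f _ _ \<mu>]) auto
    also have "8 * K^4 * (K * l) = 8 * K^5 * l" by (simp add: eval_nat_numeral)
    finally show "weighted_norm \<infinity> \<omega> l (Cohen (functional_of \<sigma>) f)
        \<le> D11 \<omega> K b p g \<sigma> l \<mu> * weighted_norm p \<omega> (8 * K^5 * l + \<mu>) (spectrogram g f)"
      by (simp add: D11_def mult_ac)
  qed
qed

end
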